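(* Let $w$ be a weakly subadditive weight on $\mathbb{R}^d$. If $1/w\in L^2(\mathbb{R}^d)$, then $\big(L^2_w(\mathbb{R}^d),\|\cdot\|_{2,w}\big)$ is a Banach algebra with respect to convolution. In this case Sobolev's embedding principle applies: if $s\ge 0$ and the weight $w=v_s$, $v_s(y)=(1+|y|^2)^{s/2}$, satisfies $1/v_s\in L^2(\mathbb{R}^d)$, then $\mathcal{H}_s(\mathbb{R}^d)$ is continuously embedded into $\big(C_0(\mathbb{R}^d),\|\cdot\|_\infty\big)$.
   Context: A weight is a measurable function $w:\mathbb{R}^d\to(0,\infty)$. It is called weakly subadditive (WSA) if there is a constant $C>0$ with $w(x+y)\le C\,[w(x)+w(y)]$ for all $x,y\in\mathbb{R}^d$. $L^2_w(\mathbb{R}^d)$ is the space of (classes of) measurable functions $f$ with $fw\in L^2(\mathbb{R}^d)$, with norm $\|f\|_{2,w}=\|fw\|_{L^2}$. Convolution is $(f*g)(x)=\int_{\mathbb{R}^d}f(x-y)g(y)\,dy$. Convention: "Banach algebra" means a Banach space with a bilinear associative product satisfying $\|f*g\|\le C'\|f\|\,\|g\|$ for some constant $C'$; the constant can be made equal to $1$ by replacing the norm by a constant multiple. The Sobolev space is $\mathcal{H}_s(\mathbb{R}^d)=\{f:\hat f\cdot v_s\in L^2(\mathbb{R}^d)\}$ with norm $\|f\|_{\mathcal{H}_s}=\|\hat f\,v_s\|_{L^2}$, where $\hat f$ is the Fourier transform, normalized as $\hat f(s)=\int f(t)e^{-2\pi i s\cdot t}dt$ for integrable $f$. $C_0(\mathbb{R}^d)$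 is the space of continuous complex-valued functions vanishing at infinity; the embedding means that every $f\in\mathcal{H}_s$ has a (unique) representative in $C_0$ and $\|f\|_\infty\le C''\|f\|_{\mathcal{H}_s}$ for a constant $C''$ independent of $f$. *)

theory Defs
  imports "HOL-Analysis.Analysis"
begin

subsection \<open>Weights and square integrability\<close>

definition weight :: "('a::euclidean_space \<Rightarrow> real) \<Rightarrow> bool" where
  "weight w \<longleftrightarrow> w \<in> borel_measurable lebesgue \<and> (\<forall>x. w x > 0)"

definition weakly_subadditive :: "('a::euclidean_space \<Rightarrow> real) \<Rightarrow> bool" where
  "weakly_subadditive w \<longleftrightarrow> (\<exists>C>0. \<forall>x y. w (x + y) \<le> C * (w x + w y))"

definition square_integrable :: "('a::euclidean_space \<Rightarrow> 'b::real_normed_vector) \<Rightarrow> bool" where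
  "square_integrable f \<longleftrightarrow>
     f \<in> borel_measurable lebesgue \<and> integrable lebesgue (\<lambda>x. (norm (f x))\<^sup>2)"

text \<open>Only meaningful for square integrable functions, since the Bochner integral of a
  non-integrable function is 0.\<close>

definition l2_norm :: "('a::euclidean_space \<Rightarrow> 'b::real_normed_vector) \<Rightarrow> real" where
  "l2_norm f = sqrt (integral\<^sup>L lebesgue (\<lambda>x. (norm (f x))\<^sup>2))"

definition sobolev_weight :: "real \<Rightarrow> 'a::euclidean_space \<Rightarrow> real" where
  "sobolev_weight s y = (1 + (norm y)\<^sup>2) powr (s / 2)"


subsection \<open>Convolution of functions\<close>

definition convolve ::
  "('a::euclidean_space \<Rightarrow> complex) \<Rightarrow> ('a \<Rightarrow> complex) \<Rightarrow> 'a \<Rightarrow> complex" where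
  "convolve f g x = integral\<^sup>L lebesgue (\<lambda>y. f (x - y) * g y)"

lemma AE_lebesgue_reflect:
  fixes x :: "'a::euclidean_space"
  assumes "AE y in lebesgue. P y"
  shows "AE y in lebesgue. P (x - y)"
proof -
  have eq: "(lborel::'a measure) = density (distr lborel borel (\<lambda>y. x + (-1) *\<^sub>R y)) (\<lambda>_. 1)"
    using lborel_affine[of "-1" x] by simp
  have "AE y in (lborel::'a measure). P y"
    using assms by (simp add: AE_completion_iff)
  then have "AE y in distr lborel borel (\<lambda>y. x + (-1) *\<^sub>R y). P y"
    by (subst (asm) eq) (simp only: density_1)
  then have "AE y in lborel. P (x + (-1) *\<^sub>R y)"
    by (rule AE_distrD[rotated]) simp
  then show ?thesis
    by (simp add: AE_completion_iff)
qed

lemma integral_lebesgue_cong_AE: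
  fixes f g :: "'a::euclidean_space \<Rightarrow> complex"
  assumes "AE x in lebesgue. f x = g x"
  shows "integral\<^sup>L lebesgue f = integral\<^sup>L lebesgue g"
proof (cases "f \<in> borel_measurable lebesgue")
  case True
  then have "g \<in> borel_measurable lebesgue"
    by (rule borel_measurable_AE) (use assms in auto)
  with True assms show ?thesis by (intro integral_cong_AE)
next
  case False
  then have "g \<notin> borel_measurable lebesgue"
    using borel_measurable_AE[of g f] assms by (auto simp: eq_commute)
  with False show ?thesis
    by (metis borel_measurable_integrable not_integrable_integral_eq)
qed

lemma convolve_cong_AE:
  assumes "AE x in lebesgue. f x = f' x" "AE x in lebesgue. g x = g' x"
  shows "convolve f g = convolve f' g'"
proof
  fix x
  show "convolve f g x = convolve f' g' x"
    unfolding convolve_def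
    by (rule integral_lebesgue_cong_AE)
       (use AE_lebesgue_reflect[OF assms(1), of x] assms(2) in eventually_elim, simp)
qed

lemma borel_version:
  fixes f :: "'a::euclidean_space \<Rightarrow> complex"
  assumes "f \<in> borel_measurable lebesgue"
  obtains f' where "f' \<in> borel_measurable borel" "AE x in lebesgue. f x = f' x"
proof -
  have "(\<lambda>x. Re (f x)) \<in> borel_measurable lebesgue" "(\<lambda>x. Im (f x)) \<in> borel_measurable lebesgue"
    using assms by auto
  then obtain a b where ab: "a \<in> borel_measurable lborel" "AE x in lborel. Re (f x) = a x"
      "b \<in> borel_measurable lborel" "AE x in lborel. Im (f x) = b x"
    using completion_ex_borel_measurable_real[of "\<lambda>x. Re (f x)" lborel]
      completion_ex_borel_measurable_real[of "\<lambda>x. Im (f x)" lborel] that by blast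
  have "(\<lambda>x. Complex (a x) (b x)) \<in> borel_measurable borel"
    using ab by (subst borel_measurable_complex_iff) simp
  moreover have "AE x in lebesgue. f x = Complex (a x) (b x)"
    unfolding AE_completion_iff using ab(2,4) by eventually_elim (simp add: complex_eq_iff)
  ultimately show thesis by (rule that)
qed

lemma borel_measurable_convolve:
  fixes f g :: "'a::euclidean_space \<Rightarrow> complex"
  assumes "f \<in> borel_measurable lebesgue" "g \<in> borel_measurable lebesgue"
  shows "convolve f g \<in> borel_measurable lebesgue"
proof -
  obtain f' where f': "f' \<in> borel_measurable borel" "AE x in lebesgue. f x = f' x"
    using borel_version[OF assms(1)] .
  obtain g' where g': "g' \<in> borel_measurable borel" "AE x in lebesgue. g x = g' x"
    using borel_version[OF assms(2)] .
  note [measurable] = f'(1) g'(1)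
  have "(\<lambda>x. integral\<^sup>L lborel (\<lambda>y. f' (x - y) * g' y)) \<in> borel_measurable lborel"
    by measurable
  also have "(\<lambda>x. integral\<^sup>L lborel (\<lambda>y. f' (x - y) * g' y)) = convolve f' g'"
    unfolding convolve_def by (intro ext integral_completion[symmetric]) simp
  also have "\<dots> = convolve f g"
    using convolve_cong_AE[OF f'(2) g'(2)] by simp
  finally show ?thesis by (rule measurable_completion)
qed


subsection \<open>Classes of measurable functions\<close>

lemma AE_eq_map: "AE x in M. f x = f' x \<Longrightarrow> AE x in M. k (f x) = k (f' x)"
  by (erule eventually_mono) simp

lemma AE_eq_map2:
  assumes "AE x in M. f x = f' x" "AE x in M. g x = g' x"
  shows "AE x in M. k (f x) (g x) = k (f' x) (g' x)"
  using assms by eventually_elim simp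

quotient_type (overloaded) 'a ae_fun = "'a::euclidean_space \<Rightarrow> complex" / partial:
    "\<lambda>f g. f \<in> borel_measurable lebesgue \<and> g \<in> borel_measurable lebesgue \<and>
       (AE x in lebesgue. f x = g x)"
  morphisms repr ae_class
proof (rule part_equivpI)
  show "\<exists>f::'a \<Rightarrow> complex. f \<in> borel_measurable lebesgue \<and> f \<in> borel_measurable lebesgue \<and>
          (AE x in lebesgue. f x = f x)"
    by (rule exI[of _ "\<lambda>_. 0"]) simp
next
  show "symp (\<lambda>f g :: 'a \<Rightarrow> complex. f \<in> borel_measurable lebesgue \<and>
          g \<in> borel_measurable lebesgue \<and> (AE x in lebesgue. f x = g x))"
    by (simp add: symp_def eq_commute)
next
  show "transp (\<lambda>f g :: 'a \<Rightarrow> complex. f \<in> borel_measurable lebesgue \<and>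
          g \<in> borel_measurable lebesgue \<and> (AE x in lebesgue. f x = g x))"
  proof (rule transpI, elim conjE, intro conjI)
    fix f g h :: "'a \<Rightarrow> complex"
    assume "AE x in lebesgue. f x = g x" "AE x in lebesgue. g x = h x"
    then show "AE x in lebesgue. f x = h x" by eventually_elim simp
  qed
qed

instantiation ae_fun :: (euclidean_space) ab_group_add
begin

lift_definition zero_ae_fun :: "'a ae_fun" is "\<lambda>_. 0" by simp

lift_definition plus_ae_fun :: "'a ae_fun \<Rightarrow> 'a ae_fun \<Rightarrow> 'a ae_fun" is "\<lambda>f g x. f x + g x"
  by (elim conjE, intro conjI borel_measurable_add;
      (assumption | rule AE_eq_map2[where k = "(+)"], assumption, assumption))

lift_definition minus_ae_fun :: "'a ae_fun \<Rightarrow> 'a ae_fun \<Rightarrow> 'a ae_fun" is "\<lambda>f g x. f x - g x"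
  by (elim conjE, intro conjI borel_measurable_diff;
      (assumption | rule AE_eq_map2[where k = "(-)"], assumption, assumption))

lift_definition uminus_ae_fun :: "'a ae_fun \<Rightarrow> 'a ae_fun" is "\<lambda>f x. - f x"
  by (elim conjE, intro conjI borel_measurable_uminus;
      (assumption | rule AE_eq_map[where k = uminus], assumption))

instance
proof
  fix F G H :: "'a ae_fun"
  show "F + G + H = F + (G + H)" by transfer (simp add: add.assoc)
  show "F + G = G + F" by transfer (simp add: add.commute)
  show "0 + F = F" by transfer simp
  show "- F + F = 0" by transfer simp
  show "F - G = F + - G" by transfer simp
qed

end

lift_definition scale_ae :: "complex \<Rightarrow> 'a::euclidean_space ae_fun \<Rightarrow> 'a ae_fun"
  is "\<lambda>c f x. c * f x"
  subgoal for c f f'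
    using AE_eq_map[where f = f and f' = f' and k = "(*) c"] by (simp add: borel_measurable_times)
  done

lift_definition convolution ::
  "'a::euclidean_space ae_fun \<Rightarrow> 'a ae_fun \<Rightarrow> 'a ae_fun" is convolve
proof (elim conjE, intro conjI)
  fix f f' g g' :: "'a \<Rightarrow> complex"
  assume "f \<in> borel_measurable lebesgue" "g \<in> borel_measurable lebesgue"
  then show "convolve f g \<in> borel_measurable lebesgue" by (rule borel_measurable_convolve)
next
  fix f f' g g' :: "'a \<Rightarrow> complex"
  assume "f' \<in> borel_measurable lebesgue" "g' \<in> borel_measurable lebesgue"
  then show "convolve f' g' \<in> borel_measurable lebesgue" by (rule borel_measurable_convolve)
next
  fix f f' g g' :: "'a \<Rightarrow> complex"
  assume "AE x in lebesgue. f x = f' x" "AE x in lebesgue. g x = g' x"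
  then have "convolve f g = convolve f' g'" by (rule convolve_cong_AE)
  then show "AE x in lebesgue. convolve f g x = convolve f' g' x" by simp
qed


subsection \<open>Weighted spaces and Banach algebras\<close>

definition L2w :: "('a::euclidean_space \<Rightarrow> real) \<Rightarrow> 'a ae_fun set" where
  "L2w w = {F. square_integrable (\<lambda>x. repr F x * of_real (w x))}"

definition L2w_norm :: "('a::euclidean_space \<Rightarrow> real) \<Rightarrow> 'a ae_fun \<Rightarrow> real" where
  "L2w_norm w F = l2_norm (\<lambda>x. repr F x * of_real (w x))"

text \<open>A Banach algebra carried by a subspace \<open>V\<close> of an ambient complex vector space. The
  product need neither be commutative nor have a unit, and is submultiplicative only up to
  a constant.\<close>

locale banach_algebra_on = vector_space scale
  for scale :: "complex \<Rightarrow> 'v::ab_group_add \<Rightarrow> 'v" +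
  fixes V :: "'v set" and nrm :: "'v \<Rightarrow> real" and mult :: "'v \<Rightarrow> 'v \<Rightarrow> 'v"
  assumes subspace_V: "subspace V"
    and nrm_nonneg: "x \<in> V \<Longrightarrow> nrm x \<ge> 0"
    and nrm_eq_0_iff: "x \<in> V \<Longrightarrow> nrm x = 0 \<longleftrightarrow> x = 0"
    and nrm_triangle: "x \<in> V \<Longrightarrow> y \<in> V \<Longrightarrow> nrm (x + y) \<le> nrm x + nrm y"
    and nrm_scale: "x \<in> V \<Longrightarrow> nrm (scale c x) = cmod c * nrm x"
    and complete: "Metric_space.mcomplete V (\<lambda>x y. nrm (x - y))"
    and mult_closed: "x \<in> V \<Longrightarrow> y \<in> V \<Longrightarrow> mult x y \<in> V"
    and mult_add_left: "x \<in> V \<Longrightarrow> y \<in> V \<Longrightarrow> z \<in> V \<Longrightarrow> mult (x + y) z = mult x z + mult y z"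
    and mult_add_right: "x \<in> V \<Longrightarrow> y \<in> V \<Longrightarrow> z \<in> V \<Longrightarrow> mult x (y + z) = mult x y + mult x z"
    and mult_scale_left: "x \<in> V \<Longrightarrow> y \<in> V \<Longrightarrow> mult (scale c x) y = scale c (mult x y)"
    and mult_scale_right: "x \<in> V \<Longrightarrow> y \<in> V \<Longrightarrow> mult x (scale c y) = scale c (mult x y)"
    and mult_assoc: "x \<in> V \<Longrightarrow> y \<in> V \<Longrightarrow> z \<in> V \<Longrightarrow> mult (mult x y) z = mult x (mult y z)"
    and mult_bounded: "\<exists>C. \<forall>x\<in>V. \<forall>y\<in>V. nrm (mult x y) \<le> C * nrm x * nrm y"


subsection \<open>Fourier transform, Sobolev spaces and continuous functions vanishing at infinity\<close>

definition fourier_L1 :: "('a::euclidean_space \<Rightarrow> complex) \<Rightarrow> 'a \<Rightarrow> complex" where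
  "fourier_L1 f \<xi> = integral\<^sup>L lebesgue (\<lambda>t. f t * exp (- 2 * of_real pi * \<i> * of_real (\<xi> \<bullet> t)))"

text \<open>The Fourier transform on \<open>L\<^sup>2\<close> is the continuous extension of the integral transform from
  \<open>L\<^sup>1 \<inter> L\<^sup>2\<close>, given here through its graph. Requiring the transforms of the approximating
  functions to be square integrable is no restriction by Plancherel's theorem; it makes the
  second limit meaningful.\<close>

definition has_fourier_L2 :: "'a::euclidean_space ae_fun \<Rightarrow> 'a ae_fun \<Rightarrow> bool" where
  "has_fourier_L2 F G \<longleftrightarrow>
     square_integrable (repr F) \<and> square_integrable (repr G) \<and>
     (\<exists>f :: nat \<Rightarrow> 'a \<Rightarrow> complex.
        (\<forall>n. integrable lebesgue (f n) \<and> square_integrable (f n) \<and>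
             square_integrable (fourier_L1 (f n))) \<and>
        (\<lambda>n. l2_norm (\<lambda>x. f n x - repr F x)) \<longlonglongrightarrow> 0 \<and>
        (\<lambda>n. l2_norm (\<lambda>\<xi>. fourier_L1 (f n) \<xi> - repr G \<xi>)) \<longlonglongrightarrow> 0)"

definition fourier_L2 :: "'a::euclidean_space ae_fun \<Rightarrow> 'a ae_fun" where
  "fourier_L2 F = (THE G. has_fourier_L2 F G)"

text \<open>For \<open>s \<ge> 0\<close> the Sobolev weight is at least 1, so that \<open>H\<^sub>s\<close> consists of
  \<open>L\<^sup>2\<close>-classes and no distributional Fourier transform is needed.\<close>

definition sobolev_space :: "real \<Rightarrow> 'a::euclidean_space ae_fun set" where
  "sobolev_space s = {F. \<exists>G. has_fourier_L2 F G \<and> G \<in> L2w (sobolev_weight s)}"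

definition sobolev_norm :: "real \<Rightarrow> 'a::euclidean_space ae_fun \<Rightarrow> real" where
  "sobolev_norm s F = L2w_norm (sobolev_weight s) (fourier_L2 F)"

definition C0 :: "('a::euclidean_space \<Rightarrow> complex) set" where
  "C0 = {h. continuous_on UNIV h \<and> (h \<longlongrightarrow> 0) at_infinity}"

definition sup_norm :: "('a::euclidean_space \<Rightarrow> complex) \<Rightarrow> real" where
  "sup_norm h = (SUP x. cmod (h x))"

definition continuously_embedded_C0 ::
  "'a::euclidean_space ae_fun set \<Rightarrow> ('a ae_fun \<Rightarrow> real) \<Rightarrow> bool" where
  "continuously_embedded_C0 V nrm \<longleftrightarrow>
     (\<forall>F\<in>V. \<exists>!h. h \<in> C0 \<and> ae_class h = F) \<and>
     (\<exists>C. \<forall>F\<in>V. \<forall>h\<in>C0. ae_class h = F \<longrightarrow> sup_norm h \<le> C * nrm F)"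

end

theory Submission
  imports "HOL-Probability.Characteristic_Functions" Defs
begin

text \<open>
  Both halves rest on one consequence of the Cauchy--Schwarz inequality: if \<open>1/w\<close> is square
  integrable, then \<open>f = (f w) (1/w)\<close> shows \<open>\<parallel>f\<parallel>\<^sub>1 \<le> \<parallel>1/w\<parallel>\<^sub>2 \<parallel>f w\<parallel>\<^sub>2\<close>, so that the weighted space sits
  continuously inside \<open>L\<^sup>1\<close>
  (\<open>weighted_square_integrable_imp_integrable\<close>).

  Banach algebra. Because the elements of the space are integrable, their convolutions exist almost
  everywhere, and bilinearity and associativity follow from Fubini's theorem. Weak subadditivity at
  \<open>x = (x - y) + y\<close> gives pointwise
  \<open>|f * g| w \<le> C ((|f| w) * |g| + |f| * (|g| w))\<close>, and Young's inequality
  \<open>\<parallel>p * q\<parallel>\<^sub>2 \<le> \<parallel>p\<parallel>\<^sub>2 \<parallel>q\<parallel>\<^sub>1\<close> bounds both terms by \<open>\<parallel>1/w\<parallel>\<^sub>2 \<parallel>f w\<parallel>\<^sub>2 \<parallel>g w\<parallel>\<^sub>2\<close>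
  (\<open>convolution_weighted_bound\<close>). For completeness, a rapidly converging subsequence of a Cauchy
  sequence converges almost everywhere by the \<open>L\<^sup>1\<close> bound, and Fatou's lemma identifies the pointwise
  limit as the limit in norm (\<open>L2w_complete\<close>).

  Sobolev embedding. Let \<open>G\<close> be the Fourier transform of \<open>F\<close>. As \<open>G v\<^sub>s\<close> is square integrable, \<open>G\<close>
  is integrable, and the inverse transform \<open>h\<close> of \<open>G\<close> is uniformly continuous and bounded by
  \<open>\<parallel>G\<parallel>\<^sub>1\<close>. The main point is that \<open>h\<close> represents \<open>F\<close> although the transform on \<open>L\<^sup>2\<close> is only given
  through limits. Passing to the limit in \<open>\<integral> \<hat>f \<phi> = \<integral> f \<hat>\<phi>\<close> yields the pairing
  \<open>\<integral> G \<phi> = \<integral> F \<hat>\<phi>\<close> for nice \<open>\<phi>\<close> (\<open>has_fourier_L2_pairing\<close>), with \<open>\<hat>\<phi>\<close> the transform of \<open>\<phi>\<close>. With \<open>\<phi>\<close> a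
  modulated Gaussian this says that the Gaussian averages of \<open>F\<close> are inverse transforms of \<open>G\<close>
  damped by a Gaussian, which tend to \<open>h\<close> pointwise as the averaging scale shrinks. Since a square
  integrable function is determined by such a limit of its Gaussian averages
  (\<open>AE_eq_mollification_limit\<close>), \<open>F = h\<close> almost everywhere (\<open>fourier_L2_inversion\<close>). The same
  principle, with translated Gaussians for \<open>\<phi>\<close>, shows that \<open>G\<close> is determined by \<open>F\<close>
  (\<open>has_fourier_L2_unique\<close>), so that the Sobolev norm is the weighted norm of this very \<open>G\<close>.
  Finally \<open>h\<close> vanishes at infinity because it is uniformly continuous and, being equal to \<open>F\<close>
  almost everywhere, square integrable.
\<close>

section \<open>Square integrable functions\<close>

lemma square_integrable_mult:
  fixes f :: "'a::euclidean_space \<Rightarrow> 'b::real_normed_vector" and g :: "'a \<Rightarrow> 'c::real_normed_vector"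
  assumes f: "square_integrable f" and g: "square_integrable g"
  shows "integrable lebesgue (\<lambda>x. norm (f x) * norm (g x))"
    and "(\<integral>x. norm (f x) * norm (g x) \<partial>lebesgue) \<le> l2_norm f * l2_norm g"
proof -
  have [measurable]: "(\<lambda>x. norm (f x)) \<in> borel_measurable lebesgue"
      "(\<lambda>x. norm (g x)) \<in> borel_measurable lebesgue"
    using f g by (auto simp: square_integrable_def intro: borel_measurable_norm)
  show int: "integrable lebesgue (\<lambda>x. norm (f x) * norm (g x))"
  proof (rule Bochner_Integration.integrable_bound)
    show "integrable lebesgue (\<lambda>x. (norm (f x))\<^sup>2 + (norm (g x))\<^sup>2)"
      using f g by (simp add: square_integrable_def)
    have "norm (f x) * norm (g x) \<le> (norm (f x))\<^sup>2 + (norm (g x))\<^sup>2" for x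
    proof -
      have "0 \<le> norm (f x) * norm (g x)" by simp
      then show ?thesis
        using sum_squares_bound[of "norm (f x)" "norm (g x)"] unfolding mult.assoc by linarith
    qed
    then show "AE x in lebesgue. norm (norm (f x) * norm (g x))
        \<le> norm ((norm (f x))\<^sup>2 + (norm (g x))\<^sup>2)"
      by simp
  qed simp
  define I where "I = (\<integral>x. norm (f x) * norm (g x) \<partial>lebesgue)"
  define A where "A = (\<integral>x. (norm (f x))\<^sup>2 \<partial>lebesgue)"
  define B where "B = (\<integral>x. (norm (g x))\<^sup>2 \<partial>lebesgue)"
  have nn: "I \<ge> 0" "A \<ge> 0" "B \<ge> 0"
    by (simp_all add: I_def A_def B_def)
  have "(\<integral>\<^sup>+x. ennreal (norm (f x)) * ennreal (norm (g x)) \<partial>lebesgue) = ennreal I"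
    unfolding I_def using int by (simp add: nn_integral_eq_integral flip: ennreal_mult)
  moreover have "(\<integral>\<^sup>+x. (ennreal (norm (f x)))\<^sup>2 \<partial>lebesgue) = ennreal A"
    unfolding A_def using f by (simp add: square_integrable_def nn_integral_eq_integral ennreal_power)
  moreover have "(\<integral>\<^sup>+x. (ennreal (norm (g x)))\<^sup>2 \<partial>lebesgue) = ennreal B"
    unfolding B_def using g by (simp add: square_integrable_def nn_integral_eq_integral ennreal_power)
  ultimately have "(ennreal I)\<^sup>2 \<le> ennreal A * ennreal B"
    using Cauchy_Schwarz_nn_integral[of "\<lambda>x. ennreal (norm (f x))" lebesgue "\<lambda>x. ennreal (norm (g x))"]
    by simp
  then have "I\<^sup>2 \<le> A * B"
    using nn by (simp add: ennreal_power flip: ennreal_mult)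
  then show "I \<le> l2_norm f * l2_norm g"
    using real_le_rsqrt by (simp add: l2_norm_def A_def B_def flip: real_sqrt_mult)
qed

lemma l2_norm_nonneg [simp]: "l2_norm f \<ge> 0"
  by (simp add: l2_norm_def)

lemma l2_norm_power2: "(l2_norm f)\<^sup>2 = (\<integral>x. (norm (f x))\<^sup>2 \<partial>lebesgue)"
  by (simp add: l2_norm_def)

lemma square_integrable_add:
  fixes f g :: "'a::euclidean_space \<Rightarrow> complex"
  assumes f: "square_integrable f" and g: "square_integrable g"
  shows "square_integrable (\<lambda>x. f x + g x)"
    and "l2_norm (\<lambda>x. f x + g x) \<le> l2_norm f + l2_norm g"
proof -
  have [measurable]: "f \<in> borel_measurable lebesgue" "g \<in> borel_measurable lebesgue"
    and int: "integrable lebesgue (\<lambda>x. (norm (f x))\<^sup>2)" "integrable lebesgue (\<lambda>x. (norm (g x))\<^sup>2)"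
    using f g by (auto simp: square_integrable_def)
  note fg = square_integrable_mult[OF f g]
  have le: "(norm (f x + g x))\<^sup>2 \<le> (norm (f x))\<^sup>2 + 2 * (norm (f x) * norm (g x)) + (norm (g x))\<^sup>2" for x
    using power_mono[OF norm_triangle_ineq[of "f x" "g x"], of 2]
    by (simp add: power2_eq_square algebra_simps)
  have dom: "integrable lebesgue
      (\<lambda>x. (norm (f x))\<^sup>2 + 2 * (norm (f x) * norm (g x)) + (norm (g x))\<^sup>2)"
    using int fg by simp
  have sq: "integrable lebesgue (\<lambda>x. (norm (f x + g x))\<^sup>2)"
    by (rule Bochner_Integration.integrable_bound[OF dom]) (use le in \<open>auto intro: order_trans[OF _ abs_ge_self]\<close>)
  then show "square_integrable (\<lambda>x. f x + g x)"
    by (simp add: square_integrable_def)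
  have "(l2_norm (\<lambda>x. f x + g x))\<^sup>2
      \<le> (\<integral>x. (norm (f x))\<^sup>2 + 2 * (norm (f x) * norm (g x)) + (norm (g x))\<^sup>2 \<partial>lebesgue)"
    unfolding l2_norm_power2 by (rule integral_mono[OF sq dom le])
  also have "\<dots> = (l2_norm f)\<^sup>2 + 2 * (\<integral>x. norm (f x) * norm (g x) \<partial>lebesgue) + (l2_norm g)\<^sup>2"
    using int fg by (simp add: l2_norm_power2)
  also have "\<dots> \<le> (l2_norm f + l2_norm g)\<^sup>2"
    using fg(2) by (simp add: power2_sum)
  finally show "l2_norm (\<lambda>x. f x + g x) \<le> l2_norm f + l2_norm g"
    by (rule power2_le_imp_le) simp
qed

lemma square_integrable_mult_left:
  fixes f :: "'a::euclidean_space \<Rightarrow> complex"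
  assumes f: "square_integrable f"
  shows "square_integrable (\<lambda>x. c * f x)"
    and "l2_norm (\<lambda>x. c * f x) = cmod c * l2_norm f"
  using f by (auto simp: square_integrable_def l2_norm_def norm_mult power_mult_distrib real_sqrt_mult)

lemma square_integrable_diff:
  fixes f g :: "'a::euclidean_space \<Rightarrow> complex"
  assumes f: "square_integrable f" and g: "square_integrable g"
  shows "square_integrable (\<lambda>x. f x - g x)"
  using square_integrable_add(1)[OF f square_integrable_mult_left(1)[OF g, of "-1"]] by simp

lemma l2_norm_cong_AE:
  fixes f g :: "'a::euclidean_space \<Rightarrow> complex"
  assumes "AE x in lebesgue. f x = g x"
    and [measurable]: "f \<in> borel_measurable lebesgue" "g \<in> borel_measurable lebesgue"
  shows "l2_norm f = l2_norm g"
  unfolding l2_norm_def by (subst integral_cong_AE[where g = "\<lambda>x. (norm (g x))\<^sup>2"]) (use assms(1) in auto)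

lemma square_integrable_cong_AE:
  fixes f g :: "'a::euclidean_space \<Rightarrow> complex"
  assumes "AE x in lebesgue. f x = g x"
    and [measurable]: "f \<in> borel_measurable lebesgue" "g \<in> borel_measurable lebesgue"
  shows "square_integrable f \<longleftrightarrow> square_integrable g"
proof -
  have "integrable lebesgue (\<lambda>x. (norm (f x))\<^sup>2) \<longleftrightarrow> integrable lebesgue (\<lambda>x. (norm (g x))\<^sup>2)"
    by (rule integrable_cong_AE) (use assms(1) in auto)
  then show ?thesis by (simp add: square_integrable_def)
qed

lemma l2_norm_eq_0_AE:
  fixes f :: "'a::euclidean_space \<Rightarrow> complex"
  assumes "square_integrable f"
  shows "l2_norm f = 0 \<longleftrightarrow> (AE x in lebesgue. f x = 0)"
  using assms integral_nonneg_eq_0_iff_AE[of lebesgue "\<lambda>x. (norm (f x))\<^sup>2"]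
  by (simp add: l2_norm_def square_integrable_def)

lemma nn_integral_square_norm:
  assumes "square_integrable f"
  shows "(\<integral>\<^sup>+x. ennreal ((norm (f x))\<^sup>2) \<partial>lebesgue) = ennreal ((l2_norm f)\<^sup>2)"
  using assms by (simp add: l2_norm_power2 square_integrable_def nn_integral_eq_integral)

lemma square_integrable_nn_integral_le:
  fixes f :: "'a::euclidean_space \<Rightarrow> complex"
  assumes [measurable]: "f \<in> borel_measurable lebesgue"
    and le: "(\<integral>\<^sup>+x. ennreal ((norm (f x))\<^sup>2) \<partial>lebesgue) \<le> ennreal (K\<^sup>2)" and "K \<ge> 0"
  shows "square_integrable f" "l2_norm f \<le> K"
proof -
  have "(\<integral>\<^sup>+x. ennreal ((norm (f x))\<^sup>2) \<partial>lebesgue) < \<infinity>"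
    using le by (rule le_less_trans) simp
  then show "square_integrable f"
    by (auto simp: square_integrable_def integrable_iff_bounded)
  then have "(l2_norm f)\<^sup>2 \<le> K\<^sup>2"
    using le by (simp add: nn_integral_square_norm)
  then show "l2_norm f \<le> K"
    using \<open>K \<ge> 0\<close> by (rule power2_le_imp_le)
qed

section \<open>Classes of functions and weighted spaces\<close>

lemma borel_measurable_repr [measurable]: "repr F \<in> borel_measurable lebesgue"
  using Quotient3_rep_reflp[OF Quotient3_ae_fun, of F] by simp

lemma AE_repr_ae_class:
  assumes "f \<in> borel_measurable lebesgue"
  shows "AE x in lebesgue. repr (ae_class f) x = f x"
  using Quotient3_rep_abs[OF Quotient3_ae_fun, of f] assms by simp

lemma ae_class_eq:
  assumes "AE x in lebesgue. f x = g x" "f \<in> borel_measurable lebesgue" "g \<in> borel_measurable lebesgue"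
  shows "ae_class f = ae_class g"
  using Quotient3_rel_abs[OF Quotient3_ae_fun, of f g] assms by simp

lemma ae_class_repr [simp]: "ae_class (repr F) = F"
  by (rule Quotient3_abs_rep[OF Quotient3_ae_fun])

text \<open>If \<open>f\<close> is only Lebesgue measurable, \<open>(x, y) \<mapsto> f (x - y)\<close> need not be measurable for the product of the
  Borel algebras. Statements that rest on Fubini's theorem are therefore reduced to Borel
  representatives.\<close>

lemma ae_fun_cases:
  fixes F :: "'a::euclidean_space ae_fun"
  obtains f where "f \<in> borel_measurable borel" "F = ae_class f" "AE x in lebesgue. repr F x = f x"
proof -
  obtain f where f: "f \<in> borel_measurable borel" "AE x in lebesgue. repr F x = f x"
    using borel_version[OF borel_measurable_repr] .
  moreover have "F = ae_class f"
    using ae_class_eq[OF f(2)] f(1) by (simp add: measurable_completion)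
  ultimately show thesis by (intro that)
qed

lemma ae_class_add:
  assumes "f \<in> borel_measurable lebesgue" "g \<in> borel_measurable lebesgue"
  shows "ae_class f + ae_class g = ae_class (\<lambda>x. f x + g x)"
  using assms by (intro plus_ae_fun.abs_eq) auto

lemma ae_class_diff:
  assumes "f \<in> borel_measurable lebesgue" "g \<in> borel_measurable lebesgue"
  shows "ae_class f - ae_class g = ae_class (\<lambda>x. f x - g x)"
  using assms by (intro minus_ae_fun.abs_eq) auto

lemma scale_ae_class:
  assumes "f \<in> borel_measurable lebesgue"
  shows "scale_ae c (ae_class f) = ae_class (\<lambda>x. c * f x)"
  using assms by (intro scale_ae.abs_eq) auto

lemma convolution_ae_class:
  assumes "f \<in> borel_measurable lebesgue" "g \<in> borel_measurable lebesgue"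
  shows "convolution (ae_class f) (ae_class g) = ae_class (convolve f g)"
  using assms by (intro convolution.abs_eq) auto

lemma vector_space_scale_ae: "vector_space scale_ae"
proof
  fix a b :: complex and F G :: "'a ae_fun"
  show "scale_ae a (F + G) = scale_ae a F + scale_ae a G" by transfer (simp add: algebra_simps)
  show "scale_ae (a + b) F = scale_ae a F + scale_ae b F" by transfer (simp add: algebra_simps)
  show "scale_ae a (scale_ae b F) = scale_ae (a * b) F" by transfer (simp add: algebra_simps)
  show "scale_ae 1 F = F" by transfer simp
qed

lemma ae_class_0: "ae_class (\<lambda>_. 0) = 0"
  by (simp add: zero_ae_fun_def)

lemma L2wD: "F \<in> L2w w \<Longrightarrow> square_integrable (\<lambda>x. repr F x * of_real (w x))"
  by (simp add: L2w_def)

context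
  fixes w :: "'a::euclidean_space \<Rightarrow> real"
  assumes w_meas [measurable]: "w \<in> borel_measurable lebesgue"
begin

lemma L2w_ae_class:
  assumes [measurable]: "f \<in> borel_measurable lebesgue"
  shows "ae_class f \<in> L2w w \<longleftrightarrow> square_integrable (\<lambda>x. f x * of_real (w x))"
    and "L2w_norm w (ae_class f) = l2_norm (\<lambda>x. f x * of_real (w x))"
proof -
  have ae: "AE x in lebesgue. repr (ae_class f) x * of_real (w x) = f x * of_real (w x)"
    using AE_repr_ae_class[OF assms] by eventually_elim simp
  show "ae_class f \<in> L2w w \<longleftrightarrow> square_integrable (\<lambda>x. f x * of_real (w x))"
    unfolding L2w_def mem_Collect_eq by (rule square_integrable_cong_AE[OF ae]) measurable
  show "L2w_norm w (ae_class f) = l2_norm (\<lambda>x. f x * of_real (w x))"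
    unfolding L2w_norm_def by (rule l2_norm_cong_AE[OF ae]) measurable
qed

lemma L2w_add:
  assumes F: "F \<in> L2w w" and G: "G \<in> L2w w"
  shows "F + G \<in> L2w w" "L2w_norm w (F + G) \<le> L2w_norm w F + L2w_norm w G"
proof -
  have FG: "F + G = ae_class (\<lambda>x. repr F x + repr G x)"
    using ae_class_add[of "repr F" "repr G"] by simp
  show "F + G \<in> L2w w" "L2w_norm w (F + G) \<le> L2w_norm w F + L2w_norm w G"
    unfolding FG using square_integrable_add[OF L2wD[OF F] L2wD[OF G], folded L2w_norm_def]
    by (simp_all add: L2w_ae_class ring_distribs)
qed

lemma L2w_scale:
  assumes F: "F \<in> L2w w"
  shows "scale_ae c F \<in> L2w w" "L2w_norm w (scale_ae c F) = cmod c * L2w_norm w F"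
proof -
  have cF: "scale_ae c F = ae_class (\<lambda>x. c * repr F x)"
    using scale_ae_class[of "repr F"] by simp
  show "scale_ae c F \<in> L2w w" "L2w_norm w (scale_ae c F) = cmod c * L2w_norm w F"
    unfolding cF using square_integrable_mult_left[OF L2wD[OF F], of c, folded L2w_norm_def]
    by (simp_all add: L2w_ae_class mult.assoc)
qed

lemma L2w_norm_diff:
  "L2w_norm w (F - G) = l2_norm (\<lambda>x. (repr F x - repr G x) * of_real (w x))"
proof -
  have FG: "F - G = ae_class (\<lambda>x. repr F x - repr G x)"
    using ae_class_diff[of "repr F" "repr G"] by simp
  show ?thesis
    unfolding FG by (rule L2w_ae_class(2)) measurable
qed

lemma L2w_subspace: "module.subspace scale_ae (L2w w)"
proof -
  interpret vector_space scale_ae by (rule vector_space_scale_ae)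
  have "0 \<in> L2w w"
    unfolding ae_class_0[symmetric] by (subst L2w_ae_class) (simp_all add: square_integrable_def)
  then show ?thesis
    by (simp add: subspace_def L2w_add L2w_scale)
qed

lemma L2w_diff:
  assumes F: "F \<in> L2w w" and G: "G \<in> L2w w"
  shows "F - G \<in> L2w w"
  using module.subspace_diff[OF _ L2w_subspace F G] vector_space_scale_ae
  by (simp add: module_iff_vector_space)

end

section \<open>Integrability and completeness\<close>

text \<open>The Cauchy--Schwarz inequality for the factorisation \<open>f = (f w) (1/w)\<close>. This is the only way in
  which square integrability of \<open>1/w\<close> enters any of the arguments below.\<close>

lemma weighted_square_integrable_imp_integrable:
  fixes f :: "'a::euclidean_space \<Rightarrow> complex"
  assumes w: "\<And>x. w x > 0" and inv: "square_integrable (\<lambda>x. 1 / w x)"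
    and f [measurable]: "f \<in> borel_measurable lebesgue"
    and fw: "square_integrable (\<lambda>x. f x * of_real (w x))"
  shows "integrable lebesgue f"
    and "(\<integral>x. norm (f x) \<partial>lebesgue) \<le> l2_norm (\<lambda>x. 1 / w x) * l2_norm (\<lambda>x. f x * of_real (w x))"
proof -
  have eq: "norm (1 / w x) * norm (f x * of_real (w x)) = norm (f x)" for x
    using w[of x] by (simp add: norm_mult)
  note * = square_integrable_mult[OF inv fw, unfolded eq]
  show "integrable lebesgue f"
    using *(1) by (rule integrable_norm_cancel) measurable
  show "(\<integral>x. norm (f x) \<partial>lebesgue) \<le> l2_norm (\<lambda>x. 1 / w x) * l2_norm (\<lambda>x. f x * of_real (w x))"
    by (rule *(2))
qed

text \<open>Norm bounds survive pointwise limits. The function \<open>f\<close> is subtracted because in the completeness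
  proof the bound concerns the distance of a tail of the sequence \<open>u\<close> to one of its members.\<close>

lemma weighted_Fatou:
  fixes w :: "'a::euclidean_space \<Rightarrow> real" and u :: "nat \<Rightarrow> 'a \<Rightarrow> complex"
  assumes [measurable]: "w \<in> borel_measurable lebesgue" "g \<in> borel_measurable lebesgue"
      "f \<in> borel_measurable lebesgue" "\<And>k. u k \<in> borel_measurable lebesgue"
    and lim: "AE x in lebesgue. (\<lambda>k. u k x) \<longlonglongrightarrow> g x"
    and sq: "\<And>k. square_integrable (\<lambda>x. (u k x - f x) * of_real (w x))"
    and le: "\<And>k. k \<ge> j \<Longrightarrow> l2_norm (\<lambda>x. (u k x - f x) * of_real (w x)) \<le> e"
  shows "square_integrable (\<lambda>x. (g x - f x) * of_real (w x))"
    and "l2_norm (\<lambda>x. (g x - f x) * of_real (w x)) \<le> e"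
proof -
  define p where "p k x = ennreal ((norm ((u k x - f x) * of_real (w x)))\<^sup>2)" for k x
  have [measurable]: "p k \<in> borel_measurable lebesgue" for k
    unfolding p_def by measurable
  have e: "e \<ge> 0"
    using le[of j] l2_norm_nonneg[of "\<lambda>x. (u j x - f x) * of_real (w x)"] by linarith
  have "(\<integral>\<^sup>+x. ennreal ((norm ((g x - f x) * of_real (w x)))\<^sup>2) \<partial>lebesgue)
      = (\<integral>\<^sup>+x. liminf (\<lambda>k. p k x) \<partial>lebesgue)"
  proof (rule nn_integral_cong_AE, use lim in eventually_elim)
    case (elim x)
    have "(\<lambda>k. p k x) \<longlonglongrightarrow> ennreal ((norm ((g x - f x) * of_real (w x)))\<^sup>2)"
      unfolding p_def by (intro tendsto_intros elim)
    then show ?case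
      by (simp add: lim_imp_Liminf)
  qed
  also have "\<dots> \<le> liminf (\<lambda>k. \<integral>\<^sup>+x. p k x \<partial>lebesgue)"
    by (rule nn_integral_liminf) measurable
  also have "\<dots> \<le> ennreal (e\<^sup>2)"
  proof (rule Liminf_le)
    show "\<forall>\<^sub>F k in sequentially. (\<integral>\<^sup>+x. p k x \<partial>lebesgue) \<le> ennreal (e\<^sup>2)"
      using eventually_ge_at_top[of j]
    proof eventually_elim
      case (elim k)
      then show ?case
        unfolding p_def nn_integral_square_norm[OF sq] by (intro ennreal_leI power_mono le) simp_all
    qed
  qed simp
  finally have *: "(\<integral>\<^sup>+x. ennreal ((norm ((g x - f x) * of_real (w x)))\<^sup>2) \<partial>lebesgue) \<le> ennreal (e\<^sup>2)" .
  show "square_integrable (\<lambda>x. (g x - f x) * of_real (w x))"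
    and "l2_norm (\<lambda>x. (g x - f x) * of_real (w x)) \<le> e"
    using square_integrable_nn_integral_le[OF _ * e] by simp_all
qed

text \<open>The sum of the absolute increments has a finite integral, hence is finite almost everywhere.\<close>

lemma AE_convergent_if_summable_L1:
  fixes u :: "nat \<Rightarrow> 'a \<Rightarrow> complex"
  assumes int: "\<And>k. integrable M (\<lambda>x. u (Suc k) x - u k x)"
    and summ: "summable (\<lambda>k. \<integral>x. norm (u (Suc k) x - u k x) \<partial>M)"
  shows "AE x in M. convergent (\<lambda>k. u k x)"
proof -
  have [measurable]: "(\<lambda>x. u (Suc k) x - u k x) \<in> borel_measurable M" for k
    using int by auto
  have "(\<integral>\<^sup>+x. (\<Sum>k. ennreal (norm (u (Suc k) x - u k x))) \<partial>M)
      = (\<Sum>k. ennreal (\<integral>x. norm (u (Suc k) x - u k x) \<partial>M))"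
    using int by (subst nn_integral_suminf) (auto simp: nn_integral_eq_integral)
  also have "\<dots> \<noteq> \<infinity>"
    using summ by (subst suminf_ennreal2) auto
  finally have "AE x in M. (\<Sum>k. ennreal (norm (u (Suc k) x - u k x))) \<noteq> \<infinity>"
    by (intro nn_integral_PInf_AE) auto
  then show ?thesis
  proof eventually_elim
    case (elim x)
    then have "summable (\<lambda>k. norm (u (Suc k) x - u k x))"
      by (intro summable_suminf_not_top) auto
    then have "summable (\<lambda>k. u (Suc k) x - u k x)"
      by (rule summable_norm_cancel)
    then have "convergent (\<lambda>m. (u m x - u 0 x) + u 0 x)"
      unfolding summable_iff_convergent sum_lessThan_telescope[of "\<lambda>k. u k x"]
      by (intro convergent_add convergent_const)
    then show ?case by simp
  qed
qed

lemma L2w_metric: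
  fixes w :: "'a::euclidean_space \<Rightarrow> real"
  assumes w: "weight w"
  shows "Metric_space (L2w w) (\<lambda>F G. L2w_norm w (F - G))"
    and "F \<in> L2w w \<Longrightarrow> L2w_norm w F = 0 \<longleftrightarrow> F = 0"
proof -
  have meas [measurable]: "w \<in> borel_measurable lebesgue" and pos: "w x > 0" for x
    using w by (auto simp: weight_def)
  show eq0: "L2w_norm w F = 0 \<longleftrightarrow> F = 0" if F: "F \<in> L2w w" for F :: "'a ae_fun"
  proof -
    have "L2w_norm w F = 0 \<longleftrightarrow> (AE x in lebesgue. repr F x * of_real (w x) = 0)"
      unfolding L2w_norm_def by (rule l2_norm_eq_0_AE[OF L2wD[OF F]])
    also have "\<dots> \<longleftrightarrow> (AE x in lebesgue. repr F x = 0)"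
      using pos by (simp add: less_imp_neq[symmetric])
    also have "\<dots> \<longleftrightarrow> F = 0"
    proof
      assume "AE x in lebesgue. repr F x = 0"
      then have "ae_class (repr F) = ae_class (\<lambda>_. 0)"
        by (rule ae_class_eq) measurable
      then show "F = 0" by (simp add: ae_class_0)
    next
      assume "F = 0"
      then show "AE x in lebesgue. repr F x = 0"
        using AE_repr_ae_class[of "\<lambda>_::'a. 0"] by (simp add: ae_class_0)
    qed
    finally show ?thesis .
  qed
  show "Metric_space (L2w w) (\<lambda>F G. L2w_norm w (F - G))"
  proof
    fix F G H :: "'a ae_fun"
    show "0 \<le> L2w_norm w (F - G)"
      by (simp add: L2w_norm_def)
    show "L2w_norm w (F - G) = L2w_norm w (G - F)"
      unfolding L2w_norm_diff[OF meas] by (simp add: l2_norm_def norm_mult norm_minus_commute)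
    assume F: "F \<in> L2w w" and G: "G \<in> L2w w"
    show "L2w_norm w (F - G) = 0 \<longleftrightarrow> F = G"
      using eq0[OF L2w_diff[OF meas F G]] by simp
    assume H: "H \<in> L2w w"
    show "L2w_norm w (F - H) \<le> L2w_norm w (F - G) + L2w_norm w (G - H)"
      using L2w_add(2)[OF meas L2w_diff[OF meas F G] L2w_diff[OF meas G H]] by simp
  qed
qed

text \<open>Along a subsequence with increments below \<open>2\<^sup>-\<^sup>k\<close> in the weighted norm, the increments are
  summable in \<open>L\<^sup>1\<close> too, so this subsequence converges almost everywhere. Fatou's lemma bounds the
  distance of the pointwise limit to each late member of the original sequence.\<close>

lemma L2w_complete:
  fixes w :: "'a::euclidean_space \<Rightarrow> real"
  assumes w: "weight w" and inv: "square_integrable (\<lambda>x. 1 / w x)"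
  shows "Metric_space.mcomplete (L2w w) (\<lambda>F G. L2w_norm w (F - G))"
proof -
  interpret Metric_space "L2w w" "\<lambda>F G. L2w_norm w (F - G)"
    by (rule L2w_metric[OF w])
  have meas [measurable]: "w \<in> borel_measurable lebesgue" and pos: "w x > 0" for x
    using w by (auto simp: weight_def)
  show ?thesis
    unfolding mcomplete_def
  proof (intro allI impI)
    fix \<sigma> :: "nat \<Rightarrow> 'a ae_fun"
    assume "MCauchy \<sigma>"
    then have \<sigma>: "\<sigma> n \<in> L2w w"
      and cauchy: "\<And>e. e > 0 \<Longrightarrow> \<exists>N. \<forall>n n'. N \<le> n \<longrightarrow> N \<le> n' \<longrightarrow> L2w_norm w (\<sigma> n - \<sigma> n') < e" for n
      by (auto simp: MCauchy_def)
    have "\<forall>k. \<exists>N. \<forall>n n'. N \<le> n \<longrightarrow> N \<le> n' \<longrightarrow> L2w_norm w (\<sigma> n - \<sigma> n') < (1/2) ^ k"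
      using cauchy by simp
    then obtain N where N: "\<And>k n n'. N k \<le> n \<Longrightarrow> N k \<le> n' \<Longrightarrow> L2w_norm w (\<sigma> n - \<sigma> n') < (1/2) ^ k"
      by metis
    (* The sum bounds N j for every j up to k. *)
    define r where "r k = (\<Sum>i\<le>k. N i)" for k
    have r: "N j \<le> r k" if "j \<le> k" for j k
      unfolding r_def using that by (intro member_le_sum) auto
    define u where "u k = repr (\<sigma> (r k))" for k
    have [measurable]: "u k \<in> borel_measurable lebesgue" for k
      unfolding u_def by (rule borel_measurable_repr)
    have sq: "square_integrable (\<lambda>x. (u k x - repr (\<sigma> m) x) * of_real (w x))" for k m
      using square_integrable_diff[OF L2wD[OF \<sigma>] L2wD[OF \<sigma>]]
      by (simp add: u_def left_diff_distrib)
    have norm_u: "l2_norm (\<lambda>x. (u k x - repr (\<sigma> m) x) * of_real (w x)) = L2w_norm w (\<sigma> (r k) - \<sigma> m)" for k m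
      by (simp add: u_def L2w_norm_diff[OF meas])
    define K where "K = l2_norm (\<lambda>x. 1 / w x)"
    have int: "integrable lebesgue (\<lambda>x. u (Suc k) x - u k x)"
      and int_le: "(\<integral>x. norm (u (Suc k) x - u k x) \<partial>lebesgue) \<le> K * (1/2) ^ k" for k
    proof -
      note * = weighted_square_integrable_imp_integrable[OF pos inv _ sq, of "Suc k" "r k", folded u_def]
      show "integrable lebesgue (\<lambda>x. u (Suc k) x - u k x)"
        by (rule *(1)) measurable
      have "(\<integral>x. norm (u (Suc k) x - u k x) \<partial>lebesgue)
          \<le> K * l2_norm (\<lambda>x. (u (Suc k) x - u k x) * of_real (w x))"
        unfolding K_def by (rule *(2)) measurable
      also have "\<dots> \<le> K * (1/2) ^ k"
        using norm_u[of "Suc k" "r k", folded u_def] N[of k "r (Suc k)" "r k"] r[of k k] r[of k "Suc k"]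
        by (intro mult_left_mono) (auto simp: K_def)
      finally show "(\<integral>x. norm (u (Suc k) x - u k x) \<partial>lebesgue) \<le> K * (1/2) ^ k" .
    qed
    have "AE x in lebesgue. convergent (\<lambda>k. u k x)"
    proof (rule AE_convergent_if_summable_L1[of lebesgue u, OF int])
      show "summable (\<lambda>k. \<integral>x. norm (u (Suc k) x - u k x) \<partial>lebesgue)"
        by (rule summable_comparison_test'[where g = "\<lambda>k. K * (1/2) ^ k" and N = 0])
           (use int_le in \<open>auto intro!: summable_mult summable_geometric\<close>)
    qed
    then have lim: "AE x in lebesgue. (\<lambda>k. u k x) \<longlonglongrightarrow> lim (\<lambda>k. u k x)"
      by (simp add: convergent_LIMSEQ_iff)
    define g where "g x = lim (\<lambda>k. u k x)" for x
    have g [measurable]: "g \<in> borel_measurable lebesgue"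
      unfolding g_def by measurable
    define G where "G = ae_class g"
    have close: "square_integrable (\<lambda>x. (g x - repr (\<sigma> m) x) * of_real (w x))"
      "l2_norm (\<lambda>x. (g x - repr (\<sigma> m) x) * of_real (w x)) \<le> (1/2) ^ j" if "m \<ge> N j" for m j
    proof -
      have "l2_norm (\<lambda>x. (u k x - repr (\<sigma> m) x) * of_real (w x)) \<le> (1/2) ^ j" if "k \<ge> j" for k
        unfolding norm_u using N[of j "r k" m] r[OF that] \<open>m \<ge> N j\<close> by simp
      note weighted_Fatou[OF _ _ _ _ lim[folded g_def] sq this]
      then show "square_integrable (\<lambda>x. (g x - repr (\<sigma> m) x) * of_real (w x))"
          "l2_norm (\<lambda>x. (g x - repr (\<sigma> m) x) * of_real (w x)) \<le> (1/2) ^ j"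
        by simp_all
    qed
    have diff: "G - \<sigma> m = ae_class (\<lambda>x. g x - repr (\<sigma> m) x)" for m
      using ae_class_diff[OF g borel_measurable_repr, of "\<sigma> m"] by (simp add: G_def)
    (* The limit itself is reached from a member of the sequence at finite distance. *)
    have "G - \<sigma> (N 0) \<in> L2w w"
      unfolding diff by (subst L2w_ae_class) (use close(1)[of 0 "N 0"] in auto)
    from L2w_add(1)[OF meas this \<sigma>[of "N 0"]] have G: "G \<in> L2w w"
      by simp
    have "limitin mtopology \<sigma> G sequentially"
      unfolding limitin_metric eventually_sequentially
    proof (intro conjI G allI impI)
      fix e :: real assume "e > 0"
      then obtain j where j: "(1/2) ^ j < e"
        using real_arch_pow_inv[of e "1/2"] by auto
      have "L2w_norm w (\<sigma> m - G) < e" if "m \<ge> N j" for m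
      proof -
        have "L2w_norm w (\<sigma> m - G) \<le> (1/2) ^ j"
          using close(2)[OF that] unfolding commute[of "\<sigma> m"] diff
          by (subst L2w_ae_class) auto
        with j show ?thesis by linarith
      qed
      then show "\<exists>M. \<forall>m\<ge>M. \<sigma> m \<in> L2w w \<and> L2w_norm w (\<sigma> m - G) < e"
        using \<sigma> by blast
    qed
    then show "\<exists>G. limitin mtopology \<sigma> G sequentially" ..
  qed
qed

section \<open>Convolution on weighted spaces\<close>

lemma nn_integral_lborel_affine:
  fixes a :: "'a::euclidean_space"
  assumes "c \<noteq> 0" and "p \<in> borel_measurable borel"
  shows "(\<integral>\<^sup>+x. p x \<partial>lborel) = ennreal (\<bar>c\<bar> ^ DIM('a)) * (\<integral>\<^sup>+x. p (a + c *\<^sub>R x) \<partial>lborel)"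
  using assms(2) by (subst lborel_affine[OF assms(1), of a]) (simp add: nn_integral_density nn_integral_distr nn_integral_cmult)

lemma nn_integral_lborel_translate:
  fixes a :: "'a::euclidean_space"
  assumes "p \<in> borel_measurable borel"
  shows "(\<integral>\<^sup>+x. p (x - a) \<partial>lborel) = (\<integral>\<^sup>+x. p x \<partial>lborel)"
  using nn_integral_lborel_affine[of 1 p "- a"] assms by simp

lemma nn_integral_lborel_reflect:
  fixes a :: "'a::euclidean_space"
  assumes "p \<in> borel_measurable borel"
  shows "(\<integral>\<^sup>+x. p (a - x) \<partial>lborel) = (\<integral>\<^sup>+x. p x \<partial>lborel)"
  using nn_integral_lborel_affine[of "-1" p a] assms by simp

text \<open>Convolution of extended nonnegative functions always exists, which separates size estimates from
  questions of integrability.\<close>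

definition nn_conv :: "('a::euclidean_space \<Rightarrow> ennreal) \<Rightarrow> ('a \<Rightarrow> ennreal) \<Rightarrow> 'a \<Rightarrow> ennreal" where
  "nn_conv p q x = (\<integral>\<^sup>+y. p (x - y) * q y \<partial>lborel)"

lemma borel_measurable_nn_conv [measurable]:
  assumes [measurable]: "p \<in> borel_measurable borel" "q \<in> borel_measurable borel"
  shows "nn_conv p q \<in> borel_measurable borel"
  unfolding nn_conv_def by measurable

lemma nn_conv_commute:
  assumes [measurable]: "p \<in> borel_measurable borel" "q \<in> borel_measurable borel"
  shows "nn_conv p q x = nn_conv q p x"
  using nn_integral_lborel_reflect[of "\<lambda>y. q (x - y) * p y" x]
  by (simp add: nn_conv_def mult.commute)

lemma nn_integral_nn_conv:
  assumes [measurable]: "p \<in> borel_measurable borel" "q \<in> borel_measurable borel"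
  shows "(\<integral>\<^sup>+x. nn_conv p q x \<partial>lborel) = (\<integral>\<^sup>+x. p x \<partial>lborel) * (\<integral>\<^sup>+x. q x \<partial>lborel)"
proof -
  have "(\<integral>\<^sup>+x. nn_conv p q x \<partial>lborel) = (\<integral>\<^sup>+y. \<integral>\<^sup>+x. p (x - y) * q y \<partial>lborel \<partial>lborel)"
    unfolding nn_conv_def by (rule lborel_pair.Fubini') measurable
  also have "\<dots> = (\<integral>\<^sup>+y. (\<integral>\<^sup>+x. p x \<partial>lborel) * q y \<partial>lborel)"
    by (simp add: nn_integral_multc nn_integral_lborel_translate)
  also have "\<dots> = (\<integral>\<^sup>+x. p x \<partial>lborel) * (\<integral>\<^sup>+x. q x \<partial>lborel)"
    by (simp add: nn_integral_cmult)
  finally show ?thesis .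
qed

text \<open>The square of the integral of \<open>p\<close> against the measure with density \<open>q\<close> is at most the total mass
  of that measure times the integral of \<open>p\<^sup>2\<close>; then integrate over \<open>x\<close> by Tonelli's theorem.\<close>

lemma nn_conv_Young:
  assumes [measurable]: "p \<in> borel_measurable borel" "q \<in> borel_measurable borel"
  shows "(\<integral>\<^sup>+x. (nn_conv p q x)\<^sup>2 \<partial>lborel) \<le> (\<integral>\<^sup>+x. (p x)\<^sup>2 \<partial>lborel) * (\<integral>\<^sup>+x. q x \<partial>lborel)\<^sup>2"
proof -
  have "(nn_conv p q x)\<^sup>2 \<le> nn_conv (\<lambda>x. (p x)\<^sup>2) q x * (\<integral>\<^sup>+x. q x \<partial>lborel)" for x
    using Cauchy_Schwarz_nn_integral[of "\<lambda>y. p (x - y)" "density lborel q" "\<lambda>_. 1"]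
    by (simp add: nn_integral_density nn_conv_def mult.commute emeasure_density)
  then have "(\<integral>\<^sup>+x. (nn_conv p q x)\<^sup>2 \<partial>lborel)
      \<le> (\<integral>\<^sup>+x. nn_conv (\<lambda>x. (p x)\<^sup>2) q x * (\<integral>\<^sup>+x. q x \<partial>lborel) \<partial>lborel)"
    by (rule nn_integral_mono)
  also have "\<dots> = (\<integral>\<^sup>+x. (p x)\<^sup>2 \<partial>lborel) * (\<integral>\<^sup>+x. q x \<partial>lborel)\<^sup>2"
    by (simp add: nn_integral_multc nn_integral_nn_conv power2_eq_square mult.assoc)
  finally show ?thesis .
qed

lemma nn_conv_norm:
  fixes f g :: "'a::euclidean_space \<Rightarrow> complex"
  shows "nn_conv (\<lambda>y. ennreal (norm (f y))) (\<lambda>y. ennreal (norm (g y))) x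
    = (\<integral>\<^sup>+y. ennreal (norm (f (x - y) * g y)) \<partial>lborel)"
  by (simp add: nn_conv_def norm_mult ennreal_mult)

lemma norm_convolve_le:
  fixes f g :: "'a::euclidean_space \<Rightarrow> complex"
  assumes [measurable]: "f \<in> borel_measurable borel" "g \<in> borel_measurable borel"
  shows "ennreal (norm (convolve f g x)) \<le> nn_conv (\<lambda>y. ennreal (norm (f y))) (\<lambda>y. ennreal (norm (g y))) x"
proof -
  have "convolve f g x = (\<integral>y. f (x - y) * g y \<partial>lborel)"
    unfolding convolve_def by (rule integral_completion) measurable
  moreover have "ennreal (norm (\<integral>y. f (x - y) * g y \<partial>lborel)) \<le> (\<integral>\<^sup>+y. ennreal (norm (f (x - y) * g y)) \<partial>lborel)"
  proof (cases "integrable lborel (\<lambda>y. f (x - y) * g y)")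
    case True
    then show ?thesis by (rule integral_norm_bound_ennreal)
  qed (simp add: not_integrable_integral_eq)
  ultimately show ?thesis
    by (simp add: nn_conv_norm)
qed

lemma AE_nn_conv_finite:
  assumes [measurable]: "p \<in> borel_measurable borel" "q \<in> borel_measurable borel"
    and "(\<integral>\<^sup>+x. p x \<partial>lborel) < \<infinity>" "(\<integral>\<^sup>+x. q x \<partial>lborel) < \<infinity>"
  shows "AE x in lborel. nn_conv p q x < \<infinity>"
proof -
  have "(\<integral>\<^sup>+x. nn_conv p q x \<partial>lborel) \<noteq> \<infinity>"
    using assms(3,4) by (simp add: nn_integral_nn_conv ennreal_mult_eq_top_iff less_top[symmetric])
  then have "AE x in lborel. nn_conv p q x \<noteq> \<infinity>"
    by (intro nn_integral_PInf_AE) auto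
  then show ?thesis by (simp add: less_top)
qed

lemma AE_integrable_convolution:
  fixes f g :: "'a::euclidean_space \<Rightarrow> complex"
  assumes f: "integrable lebesgue f" and g: "integrable lebesgue g"
  shows "AE x in lebesgue. integrable lebesgue (\<lambda>y. f (x - y) * g y)"
proof -
  have [measurable]: "f \<in> borel_measurable lebesgue" "g \<in> borel_measurable lebesgue"
    using f g by auto
  obtain f' where f': "f' \<in> borel_measurable borel" "AE x in lebesgue. f x = f' x"
    using borel_version[of f] by auto
  obtain g' where g': "g' \<in> borel_measurable borel" "AE x in lebesgue. g x = g' x"
    using borel_version[of g] by auto
  note [measurable] = f'(1) g'(1)
  have [measurable]: "f' \<in> borel_measurable lebesgue" "g' \<in> borel_measurable lebesgue"
    by (simp_all add: measurable_completion)
  have "integrable lebesgue f'" "integrable lebesgue g'"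
    using f g integrable_cong_AE[OF _ _ f'(2)] integrable_cong_AE[OF _ _ g'(2)] by simp_all
  then have "integrable lborel f'" "integrable lborel g'"
    by (simp_all add: integrable_completion)
  then have "AE x in lborel. nn_conv (\<lambda>y. ennreal (norm (f' y))) (\<lambda>y. ennreal (norm (g' y))) x < \<infinity>"
    by (intro AE_nn_conv_finite) (auto simp: integrable_iff_bounded)
  then have "AE x in lborel. integrable lborel (\<lambda>y. f' (x - y) * g' y)"
    by eventually_elim (simp add: integrable_iff_bounded nn_conv_norm)
  then have "AE x in lebesgue. integrable lborel (\<lambda>y. f' (x - y) * g' y)"
    by (rule AE_completion)
  then show ?thesis
  proof eventually_elim
    case (elim x)
    then have "integrable lebesgue (\<lambda>y. f' (x - y) * g' y)"
      by (subst integrable_completion) auto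
    moreover have ae: "AE y in lebesgue. f (x - y) * g y = f' (x - y) * g' y"
      using AE_lebesgue_reflect[OF f'(2), of x] g'(2) by eventually_elim simp
    moreover have "(\<lambda>y. f (x - y) * g y) \<in> borel_measurable lebesgue"
      by (rule borel_measurable_AE[of "\<lambda>y. f' (x - y) * g' y"])
         (use ae in \<open>auto intro: measurable_completion simp: eq_commute\<close>)
    ultimately show ?case
      by (subst integrable_cong_AE[OF _ _ ae]) auto
  qed
qed

text \<open>Both sides are iterated integrals of \<open>f (x - u) g (u - y) h y\<close> over \<open>u\<close> and \<open>y\<close>. Fubini's theorem
  applies for those \<open>x\<close> at which the convolution of the absolute values is finite, that is, for almost
  every \<open>x\<close>.\<close>

lemma convolve_assoc:
  fixes f g h :: "'a::euclidean_space \<Rightarrow> complex"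
  assumes [measurable]: "f \<in> borel_measurable borel" "g \<in> borel_measurable borel" "h \<in> borel_measurable borel"
    and int: "integrable lborel f" "integrable lborel g" "integrable lborel h"
  shows "AE x in lebesgue. convolve (convolve f g) h x = convolve f (convolve g h) x"
proof -
  define p q r where "p x = ennreal (norm (f x))" and "q x = ennreal (norm (g x))"
    and "r x = ennreal (norm (h x))" for x
  have [measurable]: "p \<in> borel_measurable borel" "q \<in> borel_measurable borel" "r \<in> borel_measurable borel"
    unfolding p_def q_def r_def by measurable
  have fin: "(\<integral>\<^sup>+x. p x \<partial>lborel) < \<infinity>" "(\<integral>\<^sup>+x. q x \<partial>lborel) < \<infinity>" "(\<integral>\<^sup>+x. r x \<partial>lborel) < \<infinity>"
    using int by (simp_all add: p_def q_def r_def integrable_iff_bounded)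
  then have "(\<integral>\<^sup>+x. nn_conv q r x \<partial>lborel) < \<infinity>"
    by (simp add: nn_integral_nn_conv ennreal_mult_less_top)
  then have "AE x in lborel. nn_conv p (nn_conv q r) x < \<infinity>"
    by (intro AE_nn_conv_finite fin) auto
  then have "AE x in lborel. convolve (convolve f g) h x = convolve f (convolve g h) x"
  proof eventually_elim
    case (elim x)
    define k where "k u y = f (x - u) * (g (u - y) * h y)" for u y
    have [measurable]: "(\<lambda>(u, y). k u y) \<in> borel_measurable (lborel \<Otimes>\<^sub>M lborel)"
      unfolding k_def by measurable
    have "integrable (lborel \<Otimes>\<^sub>M lborel) (\<lambda>(u, y). k u y)"
    proof (rule integrableI_bounded)
      have "(\<integral>\<^sup>+z. ennreal (norm (case z of (u, y) \<Rightarrow> k u y)) \<partial>(lborel \<Otimes>\<^sub>M lborel))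
          = (\<integral>\<^sup>+u. \<integral>\<^sup>+y. ennreal (norm (k u y)) \<partial>lborel \<partial>lborel)"
        by (subst lborel.nn_integral_fst[symmetric]) auto
      also have "\<dots> = nn_conv p (nn_conv q r) x"
        by (simp add: nn_conv_def p_def q_def r_def k_def norm_mult ennreal_mult nn_integral_cmult)
      finally show "(\<integral>\<^sup>+z. ennreal (norm (case z of (u, y) \<Rightarrow> k u y)) \<partial>(lborel \<Otimes>\<^sub>M lborel)) < \<infinity>"
        using elim by simp
    qed simp
    note Fub = lborel_pair.Fubini_integral[OF this]
    have inner: "convolve f g (x - y) = (\<integral>u. f (x - u) * g (u - y) \<partial>lborel)" for y
    proof -
      have "convolve f g (x - y) = (\<integral>z. f (x - y - z) * g z \<partial>lborel)"
        unfolding convolve_def by (rule integral_completion) measurable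
      also have "\<dots> = (\<integral>u. f (x - u) * g (u - y) \<partial>lborel)"
        by (subst lborel_distr_plus[symmetric, of "- y"]) (simp add: integral_distr algebra_simps)
      finally show ?thesis .
    qed
    have [measurable]: "(\<lambda>y. convolve f g (x - y)) \<in> borel_measurable borel"
      unfolding inner by measurable
    have inner2: "convolve g h u = (\<integral>y. g (u - y) * h y \<partial>lborel)" for u
      unfolding convolve_def by (rule integral_completion) measurable
    have [measurable]: "convolve g h \<in> borel_measurable borel"
      unfolding inner2[abs_def] by measurable
    have "convolve (convolve f g) h x = (\<integral>y. convolve f g (x - y) * h y \<partial>lborel)"
      unfolding convolve_def[of "convolve f g"] by (rule integral_completion) measurable
    also have "\<dots> = (\<integral>y. \<integral>u. k u y \<partial>lborel \<partial>lborel)"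
    proof (rule Bochner_Integration.integral_cong[OF refl])
      fix y
      have "(\<integral>u. k u y \<partial>lborel) = (\<integral>u. (f (x - u) * g (u - y)) * h y \<partial>lborel)"
        by (simp add: k_def mult.assoc)
      then show "convolve f g (x - y) * h y = (\<integral>u. k u y \<partial>lborel)"
        unfolding inner by simp
    qed
    also have "\<dots> = (\<integral>u. \<integral>y. k u y \<partial>lborel \<partial>lborel)"
      by (rule Fub)
    also have "\<dots> = (\<integral>u. f (x - u) * convolve g h u \<partial>lborel)"
      unfolding inner2 k_def by simp
    also have "\<dots> = convolve f (convolve g h) x"
      unfolding convolve_def[of f] by (rule integral_completion[symmetric]) measurable
    finally show ?case .
  qed
  then show ?thesis by (rule AE_completion)
qed

lemma ennreal_power2_add_le: "(a + b)\<^sup>2 \<le> 2 * (a\<^sup>2 + b\<^sup>2)" for a b :: ennreal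
proof (cases a; cases b)
  fix r s assume rs: "a = ennreal r" "0 \<le> r" "b = ennreal s" "0 \<le> s"
  have "(r + s)\<^sup>2 \<le> 2 * (r\<^sup>2 + s\<^sup>2)"
    using sum_squares_bound[of r s] by (simp add: power2_sum)
  then have "ennreal ((r + s)\<^sup>2) \<le> ennreal (2 * (r\<^sup>2 + s\<^sup>2))"
    by (rule ennreal_leI)
  with rs show ?thesis
    by (simp add: ennreal_power ennreal_mult flip: ennreal_plus del: distrib_left_numeral)
qed (auto simp: ennreal_mult_top power2_eq_square)

text \<open>The quantities \<open>P\<close> and \<open>Q\<close> in the proof are Borel versions of \<open>|f| w\<close> and \<open>|g| w\<close>. Weak
  subadditivity transfers the weight at \<open>x\<close> to one of the two factors, at \<open>x - y\<close> or at \<open>y\<close>, and the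
  other factor is controlled in \<open>L\<^sup>1\<close>.\<close>

lemma convolution_weighted_bound:
  fixes w :: "'a::euclidean_space \<Rightarrow> real"
  assumes w: "weight w" and C: "C > 0" "\<And>x y. w (x + y) \<le> C * (w x + w y)"
    and inv: "square_integrable (\<lambda>x. 1 / w x)"
    and F: "F \<in> L2w w" and G: "G \<in> L2w w"
  shows "convolution F G \<in> L2w w"
    and "L2w_norm w (convolution F G)
      \<le> (2 * C * l2_norm (\<lambda>x. 1 / w x)) * L2w_norm w F * L2w_norm w G"
proof -
  have meas [measurable]: "w \<in> borel_measurable lebesgue" and pos: "w x > 0" for x
    using w by (auto simp: weight_def)
  obtain w' where w': "w' \<in> borel_measurable borel" "AE x in lebesgue. w x = w' x"
    using completion_ex_borel_measurable_real[of w lborel] meas AE_completion_iff by auto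
  obtain f where f: "f \<in> borel_measurable borel" "F = ae_class f" "AE x in lebesgue. repr F x = f x"
    by (rule ae_fun_cases)
  obtain g where g: "g \<in> borel_measurable borel" "G = ae_class g" "AE x in lebesgue. repr G x = g x"
    by (rule ae_fun_cases)
  note [measurable] = w'(1) f(1) g(1)
  have [measurable]: "f \<in> borel_measurable lebesgue" "g \<in> borel_measurable lebesgue"
    by (simp_all add: measurable_completion)
  have sqf: "square_integrable (\<lambda>x. f x * of_real (w x))" and sqg: "square_integrable (\<lambda>x. g x * of_real (w x))"
    using F G unfolding f(2) g(2) by (simp_all add: L2w_ae_class)
  define K where "K = l2_norm (\<lambda>x. 1 / w x)"
  define A where "A = L2w_norm w F"
  define B where "B = L2w_norm w G"
  have nonneg: "K \<ge> 0" "A \<ge> 0" "B \<ge> 0"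
    by (simp_all add: K_def A_def B_def L2w_norm_def)
  have A: "A = l2_norm (\<lambda>x. f x * of_real (w x))" and B: "B = l2_norm (\<lambda>x. g x * of_real (w x))"
    unfolding A_def B_def f(2) g(2) by (simp_all add: L2w_ae_class)
  define p where "p x = ennreal (norm (f x))" for x
  define q where "q x = ennreal (norm (g x))" for x
  define P where "P x = p x * ennreal (w' x)" for x
  define Q where "Q x = q x * ennreal (w' x)" for x
  have [measurable]: "p \<in> borel_measurable borel" "q \<in> borel_measurable borel"
      "P \<in> borel_measurable borel" "Q \<in> borel_measurable borel"
    unfolding p_def q_def P_def Q_def by measurable
  have L1: "(\<integral>\<^sup>+x. p x \<partial>lborel) \<le> ennreal (K * A)" "(\<integral>\<^sup>+x. q x \<partial>lborel) \<le> ennreal (K * B)"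
  proof -
    note L1f = weighted_square_integrable_imp_integrable[OF pos inv _ sqf]
    note L1g = weighted_square_integrable_imp_integrable[OF pos inv _ sqg]
    show "(\<integral>\<^sup>+x. p x \<partial>lborel) \<le> ennreal (K * A)"
      unfolding nn_integral_completion[of lborel, symmetric] p_def K_def A
      using L1f by (simp add: nn_integral_eq_integral ennreal_leI)
    show "(\<integral>\<^sup>+x. q x \<partial>lborel) \<le> ennreal (K * B)"
      unfolding nn_integral_completion[of lborel, symmetric] q_def K_def B
      using L1g by (simp add: nn_integral_eq_integral ennreal_leI)
  qed
  have L2: "(\<integral>\<^sup>+x. (P x)\<^sup>2 \<partial>lborel) = ennreal (A\<^sup>2)" "(\<integral>\<^sup>+x. (Q x)\<^sup>2 \<partial>lborel) = ennreal (B\<^sup>2)"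
  proof -
    have "(\<integral>\<^sup>+x. (P x)\<^sup>2 \<partial>lebesgue) = (\<integral>\<^sup>+x. ennreal ((norm (f x * of_real (w x)))\<^sup>2) \<partial>lebesgue)"
    proof (rule nn_integral_cong_AE, use w'(2) in eventually_elim)
      case (elim x)
      then have "P x = ennreal (norm (f x * of_real (w x)))"
        using pos[of x] by (simp add: P_def p_def norm_mult ennreal_mult)
      then show ?case
        by (simp add: ennreal_power)
    qed
    then show "(\<integral>\<^sup>+x. (P x)\<^sup>2 \<partial>lborel) = ennreal (A\<^sup>2)"
      by (simp add: nn_integral_completion A flip: nn_integral_square_norm[OF sqf])
    have "(\<integral>\<^sup>+x. (Q x)\<^sup>2 \<partial>lebesgue) = (\<integral>\<^sup>+x. ennreal ((norm (g x * of_real (w x)))\<^sup>2) \<partial>lebesgue)"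
    proof (rule nn_integral_cong_AE, use w'(2) in eventually_elim)
      case (elim x)
      then have "Q x = ennreal (norm (g x * of_real (w x)))"
        using pos[of x] by (simp add: Q_def q_def norm_mult ennreal_mult)
      then show ?case
        by (simp add: ennreal_power)
    qed
    then show "(\<integral>\<^sup>+x. (Q x)\<^sup>2 \<partial>lborel) = ennreal (B\<^sup>2)"
      by (simp add: nn_integral_completion B flip: nn_integral_square_norm[OF sqg])
  qed
  have pt: "ennreal (norm (convolve f g x * of_real (w x))) \<le> ennreal C * (nn_conv P q x + nn_conv p Q x)" for x
  proof -
    have "ennreal (norm (convolve f g x * of_real (w x))) = ennreal (norm (convolve f g x)) * ennreal (w x)"
      using pos[of x] by (simp add: norm_mult ennreal_mult)
    also have "\<dots> \<le> nn_conv p q x * ennreal (w x)"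
      unfolding p_def[abs_def] q_def[abs_def] by (intro mult_right_mono norm_convolve_le) auto
    also have "\<dots> = (\<integral>\<^sup>+y. p (x - y) * q y * ennreal (w x) \<partial>lebesgue)"
      by (simp add: nn_conv_def nn_integral_multc nn_integral_completion)
    also have "\<dots> \<le> (\<integral>\<^sup>+y. ennreal C * (P (x - y) * q y + p (x - y) * Q y) \<partial>lebesgue)"
    proof (rule nn_integral_mono_AE, use AE_lebesgue_reflect[OF w'(2), of x] w'(2) in eventually_elim)
      case (elim y)
      have "ennreal (w x) \<le> ennreal (C * (w (x - y) + w y))"
        using C(2)[of "x - y" y] by (intro ennreal_leI) simp
      also have "\<dots> = ennreal C * (ennreal (w' (x - y)) + ennreal (w' y))"
        using C(1) pos[of "x - y"] pos[of y] elim by (simp add: ennreal_mult)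
      finally have "p (x - y) * q y * ennreal (w x)
          \<le> p (x - y) * q y * (ennreal C * (ennreal (w' (x - y)) + ennreal (w' y)))"
        by (rule mult_left_mono) simp
      also have "\<dots> = ennreal C * (P (x - y) * q y + p (x - y) * Q y)"
        by (simp add: P_def Q_def algebra_simps)
      finally show ?case .
    qed
    also have "\<dots> = ennreal C * (nn_conv P q x + nn_conv p Q x)"
      by (simp add: nn_conv_def nn_integral_completion nn_integral_cmult nn_integral_add)
    finally show ?thesis .
  qed
  (* Squaring the sum costs a factor 2, and the two terms give another 2: hence the constant 2 * C * K. *)
  have "(\<integral>\<^sup>+x. ennreal ((norm (convolve f g x * of_real (w x)))\<^sup>2) \<partial>lebesgue)
      \<le> (\<integral>\<^sup>+x. (ennreal C)\<^sup>2 * (2 * ((nn_conv P q x)\<^sup>2 + (nn_conv p Q x)\<^sup>2)) \<partial>lebesgue)"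
  proof (rule nn_integral_mono)
    fix x
    have "ennreal ((norm (convolve f g x * of_real (w x)))\<^sup>2) = (ennreal (norm (convolve f g x * of_real (w x))))\<^sup>2"
      by (simp add: ennreal_power)
    also have "\<dots> \<le> (ennreal C * (nn_conv P q x + nn_conv p Q x))\<^sup>2"
      by (intro power_mono pt) simp
    also have "\<dots> \<le> (ennreal C)\<^sup>2 * (2 * ((nn_conv P q x)\<^sup>2 + (nn_conv p Q x)\<^sup>2))"
      unfolding power_mult_distrib by (intro mult_left_mono ennreal_power2_add_le) simp
    finally show "ennreal ((norm (convolve f g x * of_real (w x)))\<^sup>2)
        \<le> (ennreal C)\<^sup>2 * (2 * ((nn_conv P q x)\<^sup>2 + (nn_conv p Q x)\<^sup>2))" .
  qed
  also have "\<dots> = (ennreal C)\<^sup>2 * (2 * ((\<integral>\<^sup>+x. (nn_conv P q x)\<^sup>2 \<partial>lborel) + (\<integral>\<^sup>+x. (nn_conv Q p x)\<^sup>2 \<partial>lborel)))"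
    by (simp add: nn_integral_completion nn_integral_cmult nn_integral_add nn_conv_commute[of p Q])
  also have "\<dots> \<le> (ennreal C)\<^sup>2 * (2 * (ennreal (A\<^sup>2) * (ennreal (K * B))\<^sup>2 + ennreal (B\<^sup>2) * (ennreal (K * A))\<^sup>2))"
    using nn_conv_Young[of P q] nn_conv_Young[of Q p] L1 unfolding L2
    by (intro mult_left_mono add_mono) (auto elim!: order_trans intro!: mult_left_mono power_mono)
  also have "\<dots> = ennreal ((2 * C * K * A * B)\<^sup>2)"
    using C(1) nonneg by (simp add: ennreal_power power_mult_distrib algebra_simps flip: ennreal_mult ennreal_plus ennreal_numeral)
  finally have *: "(\<integral>\<^sup>+x. ennreal ((norm (convolve f g x * of_real (w x)))\<^sup>2) \<partial>lebesgue)
      \<le> ennreal ((2 * C * K * A * B)\<^sup>2)" .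
  have [measurable]: "convolve f g \<in> borel_measurable lebesgue"
    by (rule borel_measurable_convolve) measurable
  have "2 * C * K * A * B \<ge> 0"
    using C(1) nonneg by simp
  note bound = square_integrable_nn_integral_le[OF _ * this]
  have FG: "convolution F G = ae_class (convolve f g)"
    unfolding f(2) g(2) by (rule convolution_ae_class) measurable
  show "convolution F G \<in> L2w w"
    unfolding FG using bound(1) by (simp add: L2w_ae_class)
  show "L2w_norm w (convolution F G)
      \<le> (2 * C * l2_norm (\<lambda>x. 1 / w x)) * L2w_norm w F * L2w_norm w G"
    unfolding A_def[symmetric] B_def[symmetric] K_def[symmetric] FG
    using bound(2) by (simp add: L2w_ae_class)
qed

lemma convolution_add_left:
  assumes "integrable lebesgue (repr F)" "integrable lebesgue (repr G)" "integrable lebesgue (repr H)"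
  shows "convolution (F + G) H = convolution F H + convolution G H"
proof -
  have "F + G = ae_class (\<lambda>x. repr F x + repr G x)"
    using ae_class_add[of "repr F" "repr G"] by simp
  then have "convolution (F + G) H = ae_class (convolve (\<lambda>x. repr F x + repr G x) (repr H))"
    using convolution_ae_class[of "\<lambda>x. repr F x + repr G x" "repr H"] by simp
  also have "\<dots> = ae_class (\<lambda>x. convolve (repr F) (repr H) x + convolve (repr G) (repr H) x)"
  proof (rule ae_class_eq)
    show "AE x in lebesgue. convolve (\<lambda>x. repr F x + repr G x) (repr H) x
        = convolve (repr F) (repr H) x + convolve (repr G) (repr H) x"
      using AE_integrable_convolution[OF assms(1,3)] AE_integrable_convolution[OF assms(2,3)]
      by eventually_elim (simp add: convolve_def ring_distribs)
  qed (intro borel_measurable_convolve borel_measurable_add borel_measurable_repr)+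
  also have "\<dots> = convolution F H + convolution G H"
    using ae_class_add[of "convolve (repr F) (repr H)" "convolve (repr G) (repr H)"]
      convolution_ae_class[of "repr F" "repr H"] convolution_ae_class[of "repr G" "repr H"]
    by (simp add: borel_measurable_convolve)
  finally show ?thesis .
qed

lemma convolution_commute: "convolution F G = convolution G F"
proof -
  have "convolve (repr F) (repr G) x = convolve (repr G) (repr F) x" for x
  proof -
    obtain f where f: "f \<in> borel_measurable borel" "F = ae_class f" "AE x in lebesgue. repr F x = f x"
      by (rule ae_fun_cases)
    obtain g where g: "g \<in> borel_measurable borel" "G = ae_class g" "AE x in lebesgue. repr G x = g x"
      by (rule ae_fun_cases)
    note [measurable] = f(1) g(1)
    have "convolve f g x = (\<integral>y. f (x - y) * g y \<partial>lborel)"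
      unfolding convolve_def by (rule integral_completion) measurable
    also have "\<dots> = (\<integral>y. f y * g (x - y) \<partial>lborel)"
      by (subst lborel_affine[of "-1" x]) (simp_all add: integral_density integral_distr density_1)
    also have "\<dots> = convolve g f x"
      unfolding convolve_def by (subst integral_completion) (simp_all add: mult.commute)
    finally show ?thesis
      using convolve_cong_AE[OF f(3) g(3)] convolve_cong_AE[OF g(3) f(3)] by simp
  qed
  then have "convolve (repr F) (repr G) = convolve (repr G) (repr F)"
    by blast
  then show ?thesis
    using convolution_ae_class[of "repr F" "repr G"] convolution_ae_class[of "repr G" "repr F"] by simp
qed

lemma convolution_scale_left: "convolution (scale_ae c F) G = scale_ae c (convolution F G)"
proof -
  have "scale_ae c F = ae_class (\<lambda>x. c * repr F x)"
    using scale_ae_class[of "repr F"] by simp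
  then have "convolution (scale_ae c F) G = ae_class (convolve (\<lambda>x. c * repr F x) (repr G))"
    using convolution_ae_class[of "\<lambda>x. c * repr F x" "repr G"] by simp
  also have "convolve (\<lambda>x. c * repr F x) (repr G) = (\<lambda>x. c * convolve (repr F) (repr G) x)"
    by (simp add: convolve_def fun_eq_iff mult.assoc)
  also have "ae_class \<dots> = scale_ae c (convolution F G)"
    using scale_ae_class[of "convolve (repr F) (repr G)"] convolution_ae_class[of "repr F" "repr G"]
    by (simp add: borel_measurable_convolve)
  finally show ?thesis .
qed

lemma convolution_assoc:
  assumes int: "integrable lebesgue (repr F)" "integrable lebesgue (repr G)" "integrable lebesgue (repr H)"
  shows "convolution (convolution F G) H = convolution F (convolution G H)"
proof -
  obtain f where f: "f \<in> borel_measurable borel" "F = ae_class f" "AE x in lebesgue. repr F x = f x"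
    by (rule ae_fun_cases)
  obtain g where g: "g \<in> borel_measurable borel" "G = ae_class g" "AE x in lebesgue. repr G x = g x"
    by (rule ae_fun_cases)
  obtain h where h: "h \<in> borel_measurable borel" "H = ae_class h" "AE x in lebesgue. repr H x = h x"
    by (rule ae_fun_cases)
  note [measurable] = f(1) g(1) h(1)
  have [measurable]: "f \<in> borel_measurable lebesgue" "g \<in> borel_measurable lebesgue" "h \<in> borel_measurable lebesgue"
    by (simp_all add: measurable_completion)
  note [measurable] = borel_measurable_convolve
  have "integrable lborel f" "integrable lborel g" "integrable lborel h"
    using int integrable_cong_AE[OF _ _ f(3)] integrable_cong_AE[OF _ _ g(3)] integrable_cong_AE[OF _ _ h(3)]
    by (simp_all add: integrable_completion)
  then have "ae_class (convolve (convolve f g) h) = ae_class (convolve f (convolve g h))"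
    by (intro ae_class_eq convolve_assoc borel_measurable_convolve) measurable
  then show ?thesis
    unfolding f(2) g(2) h(2) by (simp add: convolution_ae_class borel_measurable_convolve)
qed

theorem L2w_banach_algebra:
  fixes w :: "'a::euclidean_space \<Rightarrow> real"
  assumes w: "weight w" and wsa: "weakly_subadditive w" and inv: "square_integrable (\<lambda>x. 1 / w x)"
  shows "banach_algebra_on scale_ae (L2w w) (L2w_norm w) convolution"
proof -
  have meas [measurable]: "w \<in> borel_measurable lebesgue" and pos: "w x > 0" for x
    using w by (auto simp: weight_def)
  obtain C where C: "C > 0" "\<And>x y. w (x + y) \<le> C * (w x + w y)"
    using wsa by (auto simp: weakly_subadditive_def)
  have int: "integrable lebesgue (repr F)" if "F \<in> L2w w" for F
    using weighted_square_integrable_imp_integrable(1)[OF pos inv borel_measurable_repr L2wD[OF that]] .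
  interpret vector_space scale_ae by (rule vector_space_scale_ae)
  show ?thesis
  proof
    show "subspace (L2w w)" by (rule L2w_subspace[OF meas])
    show "Metric_space.mcomplete (L2w w) (\<lambda>x y. L2w_norm w (x - y))"
      by (rule L2w_complete[OF w inv])
    show "\<exists>C. \<forall>F\<in>L2w w. \<forall>G\<in>L2w w. L2w_norm w (convolution F G) \<le> C * L2w_norm w F * L2w_norm w G"
      using convolution_weighted_bound(2)[OF w C inv] by blast
  next
    fix F G :: "'a ae_fun" assume F: "F \<in> L2w w"
    show "L2w_norm w F \<ge> 0" by (simp add: L2w_norm_def)
    show "L2w_norm w F = 0 \<longleftrightarrow> F = 0" by (rule L2w_metric(2)[OF w F])
    show "L2w_norm w (scale_ae c F) = cmod c * L2w_norm w F" for c by (rule L2w_scale(2)[OF meas F])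
    assume G: "G \<in> L2w w"
    show "L2w_norm w (F + G) \<le> L2w_norm w F + L2w_norm w G" by (rule L2w_add(2)[OF meas F G])
    show "convolution F G \<in> L2w w" by (rule convolution_weighted_bound(1)[OF w C inv F G])
    show "convolution (scale_ae c F) G = scale_ae c (convolution F G)" for c
      by (rule convolution_scale_left)
    then show "convolution F (scale_ae c G) = scale_ae c (convolution F G)" for c
      using convolution_scale_left[of c G F] by (simp add: convolution_commute)
    fix H :: "'a ae_fun" assume H: "H \<in> L2w w"
    show "convolution (F + G) H = convolution F H + convolution G H"
      by (rule convolution_add_left[OF int[OF F] int[OF G] int[OF H]])
    show "convolution F (G + H) = convolution F G + convolution F H"
      using convolution_add_left[OF int[OF G] int[OF H] int[OF F]]
      by (simp add: convolution_commute)
    show "convolution (convolution F G) H = convolution F (convolution G H)"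
      by (rule convolution_assoc[OF int[OF F] int[OF G] int[OF H]])
  qed
qed

section \<open>Gaussians and their Fourier transforms\<close>

lemma borel_measurable_cis [measurable (raw)]:
  "f \<in> borel_measurable M \<Longrightarrow> (\<lambda>x. cis (f x)) \<in> borel_measurable M"
  by (rule measurable_compose[of f M borel cis])
     (auto intro!: borel_measurable_continuous_onI continuous_intros)

lemma fourier_L1_cis: "fourier_L1 f \<xi> = (\<integral>t. f t * cis (- (2 * pi * (\<xi> \<bullet> t))) \<partial>lebesgue)"
proof -
  have "exp (- 2 * of_real pi * \<i> * of_real (\<xi> \<bullet> t)) = cis (- (2 * pi * (\<xi> \<bullet> t)))" for t
    by (simp add: cis_conv_exp mult_ac)
  then show ?thesis
    by (simp add: fourier_L1_def)
qed

lemma fourier_L1_borel: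
  assumes [measurable]: "f \<in> borel_measurable borel"
  shows "fourier_L1 f \<xi> = (\<integral>t. f t * cis (- (2 * pi * (\<xi> \<bullet> t))) \<partial>lborel)"
  unfolding fourier_L1_cis by (rule integral_completion) measurable

lemma borel_measurable_fourier_L1:
  assumes [measurable]: "f \<in> borel_measurable borel"
  shows "fourier_L1 f \<in> borel_measurable borel"
  unfolding fourier_L1_borel[OF assms, abs_def] by measurable

lemma integral_lborel_affine:
  fixes a :: "'a::euclidean_space" and f :: "'a \<Rightarrow> 'b::{banach, second_countable_topology}"
  assumes [measurable]: "f \<in> borel_measurable borel" and "c > 0"
  shows "(\<integral>x. f x \<partial>lborel) = (c ^ DIM('a)) *\<^sub>R (\<integral>x. f (a + c *\<^sub>R x) \<partial>lborel)"
  using \<open>c > 0\<close> by (subst lborel_affine[of c a]) (auto simp: integral_density integral_distr)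

lemma integrable_lborel_affine:
  fixes a :: "'a::euclidean_space" and f :: "'a \<Rightarrow> 'b::{banach, second_countable_topology}"
  assumes f: "integrable lborel f" and c: "c > 0"
  shows "integrable lborel (\<lambda>x. f (a + c *\<^sub>R x))"
proof -
  have [measurable]: "f \<in> borel_measurable borel"
    using f by auto
  show ?thesis
    using f c nn_integral_lborel_affine[of c "\<lambda>x. ennreal (norm (f x))" a]
    by (auto simp: integrable_iff_bounded ennreal_mult_less_top)
qed

lemma lborel_integral_prod:
  fixes f :: "'a::euclidean_space \<Rightarrow> real \<Rightarrow> complex"
  assumes int: "\<And>b. b \<in> Basis \<Longrightarrow> integrable lborel (f b)"
  shows "integrable lborel (\<lambda>x::'a. \<Prod>b\<in>Basis. f b (x \<bullet> b))"
    and "(\<integral>x. (\<Prod>b\<in>Basis. f b ((x::'a) \<bullet> b)) \<partial>lborel) = (\<Prod>b\<in>Basis. (\<integral>t. f b t \<partial>lborel))"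
proof -
  interpret product_sigma_finite "\<lambda>_::'a. lborel :: real measure" ..
  have [measurable]: "b \<in> Basis \<Longrightarrow> f b \<in> borel_measurable borel" for b
    using int[of b] by auto
  have [simp]: "(\<Sum>b\<in>Basis. x b *\<^sub>R b) \<bullet> b = x b" if "b \<in> Basis" for x :: "'a \<Rightarrow> real" and b
    using that by simp
  show "integrable lborel (\<lambda>x::'a. \<Prod>b\<in>Basis. f b (x \<bullet> b))"
    by (subst lborel_eq, subst integrable_distr_eq)
       (auto intro!: product_integrable_prod int cong: prod.cong)
  show "(\<integral>x. (\<Prod>b\<in>Basis. f b ((x::'a) \<bullet> b)) \<partial>lborel) = (\<Prod>b\<in>Basis. (\<integral>t. f b t \<partial>lborel))"
    by (subst lborel_eq, subst integral_distr)
       (auto intro!: product_integral_prod int cong: prod.cong)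
qed

text \<open>This normalisation makes the Gaussian its own Fourier transform, of integral 1.\<close>

definition gaussian :: "'a::real_normed_vector \<Rightarrow> real" where
  "gaussian x = exp (- (pi * (norm x)\<^sup>2))"

lemma gaussian_pos [simp]: "gaussian x > 0" and gaussian_le_1: "gaussian x \<le> 1"
  by (simp_all add: gaussian_def)

lemma borel_measurable_gaussian [measurable (raw)]:
  "f \<in> borel_measurable M \<Longrightarrow> (\<lambda>x. gaussian (f x)) \<in> borel_measurable M"
  unfolding gaussian_def by measurable

text \<open>The characteristic function of the standard normal distribution, after the substitution
  \<open>x \<mapsto> sqrt (2 \<pi>) x\<close>.\<close>

lemma gaussian_real_transform:
  fixes t :: real
  shows "integrable lborel (\<lambda>x. complex_of_real (gaussian x) * cis (- (2 * pi * (t * x))))"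
    and "(\<integral>x. complex_of_real (gaussian x) * cis (- (2 * pi * (t * x))) \<partial>lborel) = of_real (gaussian t)"
proof -
  define c where "c = sqrt (2 * pi)"
  have c: "c > 0" "c\<^sup>2 = 2 * pi" by (simp_all add: c_def)
  define f where "f x = complex_of_real (std_normal_density x) * cis (- (c * t * x))" for x :: real
  have [measurable]: "f \<in> borel_measurable borel"
    unfolding f_def by measurable
  have f_int: "integrable lborel f"
    by (rule Bochner_Integration.integrable_bound[OF integrable_std_normal_moment[of 0]])
       (auto simp: f_def norm_mult)
  have "char std_normal_distribution (- (c * t)) = (\<integral>x. f x \<partial>lborel)"
    unfolding char_def f_def
    by (subst integral_density) (auto simp: cis_conv_exp scaleR_conv_of_real mult_ac)
  then have f_val: "(\<integral>x. f x \<partial>lborel) = of_real (gaussian t)"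
    by (simp add: char_std_normal_distribution gaussian_def power_mult_distrib c)
  have eq: "f (0 + c *\<^sub>R x) * of_real c = of_real (gaussian x) * cis (- (2 * pi * (t * x)))" for x
  proof -
    have "std_normal_density (c * x) * c = gaussian x"
      using c by (simp add: std_normal_density_def gaussian_def power_mult_distrib c_def)
    moreover have "c * t * (c * x) = 2 * pi * (t * x)"
      using c(2) by (simp add: power2_eq_square algebra_simps)
    moreover have "f (0 + c *\<^sub>R x) * of_real c
        = of_real (std_normal_density (c * x) * c) * cis (- (c * t * (c * x)))"
      by (simp add: f_def)
    ultimately show ?thesis
      by (simp only:)
  qed
  show "integrable lborel (\<lambda>x. complex_of_real (gaussian x) * cis (- (2 * pi * (t * x))))"
    unfolding eq[symmetric] by (intro integrable_mult_left integrable_lborel_affine f_int c)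
  show "(\<integral>x. complex_of_real (gaussian x) * cis (- (2 * pi * (t * x))) \<partial>lborel) = of_real (gaussian t)"
    unfolding eq[symmetric] f_val[symmetric]
    by (subst integral_lborel_affine[of f c 0]) (use c in \<open>simp_all add: scaleR_conv_of_real mult.commute\<close>)
qed

lemma prod_cis: "finite A \<Longrightarrow> (\<Prod>i\<in>A. cis (f i)) = cis (\<Sum>i\<in>A. f i)"
  by (induction A rule: finite_induct) (simp_all add: cis_mult)

lemma gaussian_prod: "gaussian (x::'a::euclidean_space) = (\<Prod>b\<in>Basis. gaussian (x \<bullet> b))"
proof -
  have "(norm x)\<^sup>2 = (\<Sum>b\<in>Basis. (x \<bullet> b)\<^sup>2)"
    unfolding dot_square_norm[symmetric] by (subst euclidean_inner) (simp add: power2_eq_square)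
  then show ?thesis
    by (simp add: gaussian_def exp_sum sum_distrib_left flip: sum_negf)
qed

text \<open>The integrand is a product of functions of the single coordinates.\<close>

lemma gaussian_transform:
  fixes \<xi> :: "'a::euclidean_space"
  shows "integrable lborel (\<lambda>x::'a. complex_of_real (gaussian x) * cis (- (2 * pi * (\<xi> \<bullet> x))))"
    and "(\<integral>x. complex_of_real (gaussian x) * cis (- (2 * pi * (\<xi> \<bullet> x))) \<partial>lborel) = of_real (gaussian \<xi>)"
proof -
  have eq: "complex_of_real (gaussian x) * cis (- (2 * pi * (\<xi> \<bullet> x)))
      = (\<Prod>b\<in>Basis. complex_of_real (gaussian (x \<bullet> b)) * cis (- (2 * pi * ((\<xi> \<bullet> b) * (x \<bullet> b)))))" for x :: 'a
    unfolding gaussian_prod[of x] euclidean_inner[of \<xi> x]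
    by (simp add: prod.distrib prod_cis sum_distrib_left sum_negf)
  show "integrable lborel (\<lambda>x::'a. complex_of_real (gaussian x) * cis (- (2 * pi * (\<xi> \<bullet> x))))"
    unfolding eq by (rule lborel_integral_prod(1)) (rule gaussian_real_transform)
  show "(\<integral>x. complex_of_real (gaussian x) * cis (- (2 * pi * (\<xi> \<bullet> x))) \<partial>lborel) = of_real (gaussian \<xi>)"
    unfolding eq gaussian_prod[of \<xi>]
    by (subst lborel_integral_prod(2)) (simp_all add: gaussian_real_transform)
qed

lemma integrable_gaussian: "integrable lborel (gaussian :: 'a::euclidean_space \<Rightarrow> real)"
  and integral_gaussian: "(\<integral>x. gaussian (x::'a) \<partial>lborel) = 1"
proof -
  have "integrable lborel (\<lambda>x::'a. complex_of_real (gaussian x))"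
    using gaussian_transform(1)[of "0::'a"] by simp
  then show "integrable lborel (gaussian :: 'a \<Rightarrow> real)"
    by (simp add: complex_of_real_integrable_eq)
  have "complex_of_real (\<integral>x. gaussian (x::'a) \<partial>lborel) = 1"
    using gaussian_transform(2)[of "0::'a"] by (simp add: gaussian_def)
  then show "(\<integral>x. gaussian (x::'a) \<partial>lborel) = 1"
    by simp
qed

text \<open>The Gaussian of integral 1 and width \<open>s\<close>, centred at \<open>a\<close>.\<close>

definition gaussian_kernel :: "real \<Rightarrow> 'a::euclidean_space \<Rightarrow> 'a \<Rightarrow> complex" where
  "gaussian_kernel s a x = of_real (gaussian ((x - a) /\<^sub>R s) / s ^ DIM('a))"

text \<open>The plane wave of frequency \<open>a\<close>, damped by a Gaussian of width \<open>1/s\<close>. Its Fourier transform is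
  the kernel above.\<close>

definition gaussian_wave :: "real \<Rightarrow> 'a::euclidean_space \<Rightarrow> 'a \<Rightarrow> complex" where
  "gaussian_wave s a \<xi> = of_real (gaussian (s *\<^sub>R \<xi>)) * cis (2 * pi * (a \<bullet> \<xi>))"

lemma borel_measurable_gaussian_kernel [measurable]: "gaussian_kernel s a \<in> borel_measurable borel"
  unfolding gaussian_kernel_def by measurable

lemma borel_measurable_gaussian_wave [measurable]: "gaussian_wave s a \<in> borel_measurable borel"
  unfolding gaussian_wave_def by measurable

lemma fourier_gaussian_wave:
  assumes s: "s > 0"
  shows "fourier_L1 (gaussian_wave s a) = gaussian_kernel s a"
proof
  fix x :: 'a
  have "fourier_L1 (gaussian_wave s a) x
      = (\<integral>\<xi>. of_real (gaussian (s *\<^sub>R \<xi>)) * cis (- (2 * pi * ((x - a) \<bullet> \<xi>))) \<partial>lborel)"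
    by (subst fourier_L1_borel)
       (simp_all add: gaussian_wave_def mult.assoc cis_mult algebra_simps)
  also have "\<dots> = ((1 / s) ^ DIM('a)) *\<^sub>R
      (\<integral>\<xi>. of_real (gaussian \<xi>) * cis (- (2 * pi * (((x - a) /\<^sub>R s) \<bullet> \<xi>))) \<partial>lborel)"
    using s by (subst integral_lborel_affine[of _ "1 / s" 0]) (simp_all add: divide_inverse)
  also have "\<dots> = gaussian_kernel s a x"
    unfolding gaussian_transform by (simp add: gaussian_kernel_def scaleR_conv_of_real power_divide)
  finally show "fourier_L1 (gaussian_wave s a) x = gaussian_kernel s a x" .
qed

lemma integral_gaussian_kernel:
  fixes u :: "'a::euclidean_space \<Rightarrow> complex"
  assumes [measurable]: "u \<in> borel_measurable borel" and s: "s > 0"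
  shows "(\<integral>x. u x * gaussian_kernel s a x \<partial>lborel) = (\<integral>z. u (a + s *\<^sub>R z) * of_real (gaussian z) \<partial>lborel)"
proof -
  have "(\<integral>x. u x * gaussian_kernel s a x \<partial>lborel)
      = (s ^ DIM('a)) *\<^sub>R (\<integral>z. u (a + s *\<^sub>R z) * gaussian_kernel s a (a + s *\<^sub>R z) \<partial>lborel)"
    using s by (intro integral_lborel_affine) simp_all
  also have "\<dots> = (\<integral>z. (s ^ DIM('a)) *\<^sub>R (u (a + s *\<^sub>R z) * gaussian_kernel s a (a + s *\<^sub>R z)) \<partial>lborel)"
    by simp
  also have "\<dots> = (\<integral>z. u (a + s *\<^sub>R z) * of_real (gaussian z) \<partial>lborel)"
    using s by (intro Bochner_Integration.integral_cong) (simp_all add: gaussian_kernel_def scaleR_conv_of_real)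
  finally show ?thesis .
qed

lemma fourier_gaussian_kernel:
  assumes s: "s > 0"
  shows "fourier_L1 (gaussian_kernel s a) \<xi> = cis (- (2 * pi * (\<xi> \<bullet> a))) * of_real (gaussian (s *\<^sub>R \<xi>))"
proof -
  have "fourier_L1 (gaussian_kernel s a) \<xi>
      = (\<integral>x. cis (- (2 * pi * (\<xi> \<bullet> x))) * gaussian_kernel s a x \<partial>lborel)"
    by (subst fourier_L1_borel) (simp_all add: mult.commute)
  also have "\<dots> = (\<integral>z. cis (- (2 * pi * (\<xi> \<bullet> (a + s *\<^sub>R z)))) * of_real (gaussian z) \<partial>lborel)"
    using s by (intro integral_gaussian_kernel) measurable
  also have "\<dots> = (\<integral>z. cis (- (2 * pi * (\<xi> \<bullet> a))) *
      (of_real (gaussian z) * cis (- (2 * pi * ((s *\<^sub>R \<xi>) \<bullet> z)))) \<partial>lborel)"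
  proof (rule Bochner_Integration.integral_cong[OF refl])
    fix z
    have "cis (- (2 * pi * (\<xi> \<bullet> (a + s *\<^sub>R z))))
        = cis (- (2 * pi * (\<xi> \<bullet> a))) * cis (- (2 * pi * ((s *\<^sub>R \<xi>) \<bullet> z)))"
      by (simp add: cis_mult inner_add_right distrib_left)
    then show "cis (- (2 * pi * (\<xi> \<bullet> (a + s *\<^sub>R z)))) * of_real (gaussian z)
        = cis (- (2 * pi * (\<xi> \<bullet> a))) *
          (of_real (gaussian z) * cis (- (2 * pi * ((s *\<^sub>R \<xi>) \<bullet> z))))"
      by simp
  qed
  also have "\<dots> = cis (- (2 * pi * (\<xi> \<bullet> a))) * of_real (gaussian (s *\<^sub>R \<xi>))"
    by (simp only: integral_mult_right_zero gaussian_transform)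
  finally show ?thesis .
qed

lemma square_integrableI_bounded_L1:
  fixes f :: "'a::euclidean_space \<Rightarrow> complex"
  assumes f: "integrable lborel f" and le: "\<And>x. norm (f x) \<le> K"
  shows "square_integrable f"
proof -
  have [measurable]: "f \<in> borel_measurable borel"
    using f by auto
  have "integrable lborel (\<lambda>x. (norm (f x))\<^sup>2)"
  proof (rule Bochner_Integration.integrable_bound)
    show "integrable lborel (\<lambda>x. K * norm (f x))"
      using f by auto
    show "AE x in lborel. norm ((norm (f x))\<^sup>2) \<le> norm (K * norm (f x))"
      using le by (auto simp: power2_eq_square intro!: mult_right_mono AE_I2 order_trans[OF _ abs_ge_self])
  qed simp
  then show ?thesis
    by (simp add: square_integrable_def measurable_completion integrable_completion)
qed

lemma gaussian_wave_integrable: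
  assumes s: "s > 0"
  shows "integrable lborel (gaussian_wave s (a::'a::euclidean_space))"
    and "square_integrable (gaussian_wave s a)"
proof -
  have "integrable lborel (\<lambda>x::'a. gaussian (0 + s *\<^sub>R x))"
    by (rule integrable_lborel_affine[OF integrable_gaussian s])
  then show int: "integrable lborel (gaussian_wave s a)"
    by (rule Bochner_Integration.integrable_bound) (auto simp: gaussian_wave_def norm_mult)
  show "square_integrable (gaussian_wave s a)"
    by (rule square_integrableI_bounded_L1[OF int, of 1])
       (simp add: gaussian_wave_def norm_mult gaussian_le_1 less_imp_le)
qed

lemma gaussian_kernel_integrable:
  assumes s: "s > 0"
  shows "integrable lborel (gaussian_kernel s (a::'a::euclidean_space))"
    and "square_integrable (gaussian_kernel s a)"
proof -
  have "integrable lborel (\<lambda>x::'a. gaussian ((- a /\<^sub>R s) + (1 / s) *\<^sub>R x))"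
    using s by (intro integrable_lborel_affine[OF integrable_gaussian]) simp
  also have "(\<lambda>x::'a. gaussian ((- a /\<^sub>R s) + (1 / s) *\<^sub>R x)) = (\<lambda>x. gaussian ((x - a) /\<^sub>R s))"
    by (simp add: scaleR_diff_right divide_inverse)
  finally have "integrable lborel (\<lambda>x. complex_of_real (gaussian ((x - a) /\<^sub>R s) * (1 / s ^ DIM('a))))"
    by (intro integrable_of_real integrable_mult_left)
  then show int: "integrable lborel (gaussian_kernel s a)"
    by (simp add: gaussian_kernel_def[abs_def])
  show "square_integrable (gaussian_kernel s a)"
    by (rule square_integrableI_bounded_L1[OF int, of "1 / s ^ DIM('a)"])
       (use s in \<open>simp add: gaussian_kernel_def norm_divide gaussian_le_1 less_imp_le divide_right_mono norm_power\<close>)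
qed

lemma square_integrable_fourier_gaussian_kernel:
  assumes s: "s > 0"
  shows "square_integrable (fourier_L1 (gaussian_kernel s (a::'a::euclidean_space)))"
proof -
  have [measurable]: "fourier_L1 (gaussian_kernel s a) \<in> borel_measurable borel"
    by (rule borel_measurable_fourier_L1) measurable
  have "integrable lborel (fourier_L1 (gaussian_kernel s a))"
    by (rule Bochner_Integration.integrable_bound[OF gaussian_wave_integrable(1)[OF s, of a]])
       (simp_all add: fourier_gaussian_kernel[OF s] gaussian_wave_def norm_mult)
  then show ?thesis
    by (rule square_integrableI_bounded_L1[where K = 1])
       (simp add: fourier_gaussian_kernel[OF s] norm_mult gaussian_le_1 less_imp_le)
qed

section \<open>The pairing of a function with its transform\<close>

text \<open>By Fubini's theorem, as the kernel of the transform is symmetric.\<close>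

lemma fourier_L1_pairing:
  fixes f \<phi> :: "'a::euclidean_space \<Rightarrow> complex"
  assumes f: "integrable lebesgue f" and \<phi>: "integrable lborel \<phi>"
  shows "(\<integral>\<xi>. fourier_L1 f \<xi> * \<phi> \<xi> \<partial>lebesgue) = (\<integral>x. f x * fourier_L1 \<phi> x \<partial>lebesgue)"
proof -
  have [measurable]: "f \<in> borel_measurable lebesgue" "\<phi> \<in> borel_measurable borel"
    using f \<phi> by auto
  obtain f' where f': "f' \<in> borel_measurable borel" "AE x in lebesgue. f x = f' x"
    using borel_version[of f] by auto
  note [measurable] = f'(1)
  have [measurable]: "f' \<in> borel_measurable lebesgue"
    by (simp add: measurable_completion)
  have "integrable lebesgue f'"
    using f integrable_cong_AE[OF _ _ f'(2)] by simp
  then have intf': "integrable lborel f'"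
    by (simp add: integrable_completion)
  note [measurable] = borel_measurable_fourier_L1
  have ff': "fourier_L1 f = fourier_L1 f'"
    unfolding fun_eq_iff fourier_L1_cis
    by (intro allI integral_lebesgue_cong_AE, use f'(2) in eventually_elim) simp
  define k where "k \<xi> t = f' t * \<phi> \<xi> * cis (- (2 * pi * (\<xi> \<bullet> t)))" for \<xi> t
  have [measurable]: "(\<lambda>(\<xi>, t). k \<xi> t) \<in> borel_measurable (lborel \<Otimes>\<^sub>M lborel)"
    unfolding k_def by measurable
  have "integrable (lborel \<Otimes>\<^sub>M lborel) (\<lambda>(\<xi>, t). k \<xi> t)"
  proof (rule integrableI_bounded)
    have "(\<integral>\<^sup>+z. ennreal (norm (case z of (\<xi>, t) \<Rightarrow> k \<xi> t)) \<partial>(lborel \<Otimes>\<^sub>M lborel))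
        = (\<integral>\<^sup>+\<xi>. \<integral>\<^sup>+t. ennreal (norm (k \<xi> t)) \<partial>lborel \<partial>lborel)"
      by (subst lborel.nn_integral_fst[symmetric]) auto
    also have "\<dots> = (\<integral>\<^sup>+t. ennreal (norm (f' t)) \<partial>lborel) * (\<integral>\<^sup>+\<xi>. ennreal (norm (\<phi> \<xi>)) \<partial>lborel)"
      by (simp add: k_def norm_mult ennreal_mult nn_integral_cmult nn_integral_multc)
    also have "\<dots> < \<infinity>"
      using intf' \<phi> by (simp add: integrable_iff_bounded ennreal_mult_less_top)
    finally show "(\<integral>\<^sup>+z. ennreal (norm (case z of (\<xi>, t) \<Rightarrow> k \<xi> t)) \<partial>(lborel \<Otimes>\<^sub>M lborel)) < \<infinity>" .
  qed simp
  note Fub = lborel_pair.Fubini_integral[OF this]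
  have "(\<integral>\<xi>. fourier_L1 f \<xi> * \<phi> \<xi> \<partial>lebesgue) = (\<integral>\<xi>. fourier_L1 f' \<xi> * \<phi> \<xi> \<partial>lborel)"
    unfolding ff' by (rule integral_completion) measurable
  also have "\<dots> = (\<integral>\<xi>. \<integral>t. k \<xi> t \<partial>lborel \<partial>lborel)"
  proof (rule Bochner_Integration.integral_cong[OF refl])
    fix \<xi>
    have "(\<integral>t. k \<xi> t \<partial>lborel) = (\<integral>t. (f' t * cis (- (2 * pi * (\<xi> \<bullet> t)))) * \<phi> \<xi> \<partial>lborel)"
      by (simp add: k_def mult_ac)
    then show "fourier_L1 f' \<xi> * \<phi> \<xi> = (\<integral>t. k \<xi> t \<partial>lborel)"
      by (simp add: fourier_L1_borel)
  qed
  also have "\<dots> = (\<integral>t. \<integral>\<xi>. k \<xi> t \<partial>lborel \<partial>lborel)"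
    by (rule Fub[symmetric])
  also have "\<dots> = (\<integral>t. f' t * fourier_L1 \<phi> t \<partial>lborel)"
  proof (rule Bochner_Integration.integral_cong[OF refl])
    fix t
    have "(\<integral>\<xi>. k \<xi> t \<partial>lborel) = (\<integral>\<xi>. f' t * (\<phi> \<xi> * cis (- (2 * pi * (t \<bullet> \<xi>)))) \<partial>lborel)"
      by (simp add: k_def mult.assoc inner_commute)
    then show "(\<integral>\<xi>. k \<xi> t \<partial>lborel) = f' t * fourier_L1 \<phi> t"
      by (simp add: fourier_L1_borel)
  qed
  also have "\<dots> = (\<integral>t. f' t * fourier_L1 \<phi> t \<partial>lebesgue)"
    by (rule integral_completion[symmetric]) measurable
  also have "\<dots> = (\<integral>x. f x * fourier_L1 \<phi> x \<partial>lebesgue)"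
    by (rule integral_lebesgue_cong_AE, use f'(2) in eventually_elim) simp
  finally show ?thesis .
qed

lemma tendsto_integral_L2_pairing:
  fixes f :: "nat \<Rightarrow> 'a::euclidean_space \<Rightarrow> complex"
  assumes f: "\<And>n. square_integrable (f n)" and g: "square_integrable g" and \<psi>: "square_integrable \<psi>"
    and lim: "(\<lambda>n. l2_norm (\<lambda>x. f n x - g x)) \<longlonglongrightarrow> 0"
  shows "(\<lambda>n. \<integral>x. f n x * \<psi> x \<partial>lebesgue) \<longlonglongrightarrow> (\<integral>x. g x * \<psi> x \<partial>lebesgue)"
proof -
  have int: "integrable lebesgue (\<lambda>x. u x * \<psi> x)" if u: "square_integrable u" for u :: "'a \<Rightarrow> complex"
  proof (rule integrable_norm_cancel)
    show "integrable lebesgue (\<lambda>x. norm (u x * \<psi> x))"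
      using square_integrable_mult(1)[OF u \<psi>] by (simp add: norm_mult)
    show "(\<lambda>x. u x * \<psi> x) \<in> borel_measurable lebesgue"
      using u \<psi> by (auto simp: square_integrable_def)
  qed
  have bound: "norm ((\<integral>x. f n x * \<psi> x \<partial>lebesgue) - (\<integral>x. g x * \<psi> x \<partial>lebesgue))
      \<le> l2_norm (\<lambda>x. f n x - g x) * l2_norm \<psi>" for n
  proof -
    have "(\<integral>x. f n x * \<psi> x \<partial>lebesgue) - (\<integral>x. g x * \<psi> x \<partial>lebesgue) = (\<integral>x. (f n x - g x) * \<psi> x \<partial>lebesgue)"
      using int[OF f] int[OF g] by (simp add: left_diff_distrib)
    also have "norm \<dots> \<le> (\<integral>x. norm (f n x - g x) * norm (\<psi> x) \<partial>lebesgue)"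
      using integral_norm_bound[of lebesgue "\<lambda>x. (f n x - g x) * \<psi> x"] by (simp add: norm_mult)
    also have "\<dots> \<le> l2_norm (\<lambda>x. f n x - g x) * l2_norm \<psi>"
      by (rule square_integrable_mult(2)[OF square_integrable_diff[OF f g] \<psi>])
    finally show ?thesis .
  qed
  have "(\<lambda>n. (\<integral>x. f n x * \<psi> x \<partial>lebesgue) - (\<integral>x. g x * \<psi> x \<partial>lebesgue)) \<longlonglongrightarrow> 0"
    by (rule Lim_null_comparison[where g = "\<lambda>n. l2_norm (\<lambda>x. f n x - g x) * l2_norm \<psi>"])
       (intro always_eventually allI bound, intro tendsto_mult_left_zero lim)
  then show ?thesis
    by (simp add: LIM_zero_iff)
qed

text \<open>Both sides are limits of the corresponding integrals for the approximating functions. Uniqueness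
  and inversion of the \<open>L\<^sup>2\<close> transform are obtained from this identity by choosing \<open>\<phi>\<close>.\<close>

lemma has_fourier_L2_pairing:
  fixes \<phi> :: "'a::euclidean_space \<Rightarrow> complex"
  assumes FG: "has_fourier_L2 F G"
    and \<phi>: "integrable lborel \<phi>" "square_integrable \<phi>" "square_integrable (fourier_L1 \<phi>)"
  shows "(\<integral>\<xi>. repr G \<xi> * \<phi> \<xi> \<partial>lebesgue) = (\<integral>x. repr F x * fourier_L1 \<phi> x \<partial>lebesgue)"
proof -
  obtain f :: "nat \<Rightarrow> 'a \<Rightarrow> complex" where
    f: "\<And>n. integrable lebesgue (f n)" "\<And>n. square_integrable (f n)" "\<And>n. square_integrable (fourier_L1 (f n))"
    and lim: "(\<lambda>n. l2_norm (\<lambda>x. f n x - repr F x)) \<longlonglongrightarrow> 0"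
      "(\<lambda>n. l2_norm (\<lambda>\<xi>. fourier_L1 (f n) \<xi> - repr G \<xi>)) \<longlonglongrightarrow> 0"
    and sq: "square_integrable (repr F)" "square_integrable (repr G)"
    using FG unfolding has_fourier_L2_def by blast
  have "(\<lambda>n. \<integral>\<xi>. fourier_L1 (f n) \<xi> * \<phi> \<xi> \<partial>lebesgue) \<longlonglongrightarrow> (\<integral>\<xi>. repr G \<xi> * \<phi> \<xi> \<partial>lebesgue)"
    by (rule tendsto_integral_L2_pairing[OF f(3) sq(2) \<phi>(2) lim(2)])
  moreover have "(\<lambda>n. \<integral>\<xi>. fourier_L1 (f n) \<xi> * \<phi> \<xi> \<partial>lebesgue) \<longlonglongrightarrow> (\<integral>x. repr F x * fourier_L1 \<phi> x \<partial>lebesgue)"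
    unfolding fourier_L1_pairing[OF f(1) \<phi>(1)]
    by (rule tendsto_integral_L2_pairing[OF f(2) sq(1) \<phi>(3) lim(1)])
  ultimately show ?thesis
    by (rule LIMSEQ_unique)
qed

section \<open>Recovering a function from its Gaussian averages\<close>

text \<open>Inside a fixed large box, the sets over which \<open>v\<close> has integral 0 form a Dynkin system containing
  the boxes, which are an intersection-stable generator of the Borel sets.\<close>

lemma AE_eq_0_if_box_integrals_0:
  fixes v :: "'a::euclidean_space \<Rightarrow> complex"
  assumes int: "\<And>l r. integrable lborel (\<lambda>x. indicator (box l r) x *\<^sub>R v x)"
    and zero: "\<And>l r. (\<integral>x. indicator (box l r) x *\<^sub>R v x \<partial>lborel) = 0"
  shows "AE x in lborel. v x = 0"
proof -
  define E where "E n = box (- (real n *\<^sub>R One)) (real n *\<^sub>R One :: 'a)" for n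
  have "AE x in lborel. indicator (E n) x *\<^sub>R v x = 0" for n
  proof (rule sigma_finite_measure.density_zero[OF sigma_finite_lborel])
    show intE: "integrable lborel (\<lambda>x. indicator (E n) x *\<^sub>R v x)"
      unfolding E_def by (rule int)
    fix A :: "'a set" assume "A \<in> sets lborel"
    then have A: "A \<in> sigma_sets UNIV (range (\<lambda>(l, r). box l r))"
      by (simp add: borel_eq_box)
    have sets: "A \<in> sets borel" if "A \<in> sigma_sets UNIV (range (\<lambda>(l, r). box l r))" for A :: "'a set"
      using that by (simp add: borel_eq_box)
    have intA: "integrable lborel (\<lambda>x. indicator A x *\<^sub>R (indicator (E n) x *\<^sub>R v x))"
      if "A \<in> sets borel" for A
      using that by (intro integrable_mult_indicator intE) simp
    show "set_lebesgue_integral lborel A (\<lambda>x. indicator (E n) x *\<^sub>R v x) = 0"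
      unfolding set_lebesgue_integral_def
    proof (induction rule: sigma_sets_induct_disjoint[OF _ _ A])
      case 1
      show ?case by (auto simp: Int_stable_def box_Int_box)
    next
      case 2
      show ?case by simp
    next
      case (3 B)
      then obtain l r where B: "B = box l r" by auto
      have "\<exists>l' r'. B \<inter> E n = box l' r'"
        unfolding B E_def box_Int_box by blast
      then obtain l' r' where BE: "B \<inter> E n = box l' r'"
        by blast
      have "(\<integral>x. indicator B x *\<^sub>R (indicator (E n) x *\<^sub>R v x) \<partial>lborel)
          = (\<integral>x. indicator (B \<inter> E n) x *\<^sub>R v x \<partial>lborel)"
        by (intro Bochner_Integration.integral_cong) (auto split: split_indicator)
      then show ?case
        unfolding BE zero .
    next
      case 4
      show ?case by simp
    next
      case (5 B)
      have "indicator (UNIV - B) x *\<^sub>R (indicator (E n) x *\<^sub>R v x)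
          = indicator (E n) x *\<^sub>R v x - indicator B x *\<^sub>R (indicator (E n) x *\<^sub>R v x)" for x
        by (simp split: split_indicator)
      then show ?case
        using intE intA[OF sets[OF 5(1)]] 5(2) zero by (simp add: E_def)
    next
      case (6 B)
      have B: "B i \<in> sets borel" for i
        using 6(2) by (intro sets) auto
      have "(LINT x:(\<Union>i. B i)|lborel. indicator (E n) x *\<^sub>R v x)
          = (\<Sum>i. (LINT x:B i|lborel. indicator (E n) x *\<^sub>R v x))"
      proof (rule lebesgue_integral_countable_add)
        show "i \<noteq> j \<Longrightarrow> B i \<inter> B j = {}" for i j
          using 6(1) by (auto simp: disjoint_family_on_def)
        show "set_integrable lborel (\<Union>i. B i) (\<lambda>x. indicator (E n) x *\<^sub>R v x)"
          unfolding set_integrable_def using B by (intro intA) auto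
      qed (use B in auto)
      then show ?case
        using 6(3) by (simp add: set_lebesgue_integral_def)
    qed
  qed
  then have "AE x in lborel. \<forall>n. indicator (E n) x *\<^sub>R v x = 0"
    unfolding AE_all_countable by blast
  then show ?thesis
  proof eventually_elim
    case (elim x)
    obtain n where "x \<in> E n"
      using UN_box_eq_UNIV unfolding E_def by blast
    then show ?case
      using elim by (auto simp: indicator_def)
  qed
qed

lemma le_1_plus_square: "(t :: real) \<le> 1 + t\<^sup>2"
proof -
  have "0 \<le> (t - 1)\<^sup>2 + t\<^sup>2 + 1" by simp
  also have "\<dots> = 2 * (1 + t\<^sup>2 - t)" by (simp add: power2_eq_square algebra_simps)
  finally show ?thesis by simp
qed

lemma set_integrable_of_square_integrable:
  fixes u :: "'a::euclidean_space \<Rightarrow> complex"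
  assumes [measurable]: "u \<in> borel_measurable borel" and u: "square_integrable u"
    and S: "S \<in> sets borel" "bounded S"
  shows "integrable lborel (\<lambda>x. indicator S x *\<^sub>R u x)"
proof (rule Bochner_Integration.integrable_bound)
  have "integrable lborel (\<lambda>x. indicator S x :: real)"
    using S emeasure_bounded_finite[OF S(2)] by (simp add: integrable_indicator_iff)
  moreover have "integrable lborel (\<lambda>x. (norm (u x))\<^sup>2)"
    using u by (simp add: square_integrable_def integrable_completion)
  ultimately show "integrable lborel (\<lambda>x. indicator S x + (norm (u x))\<^sup>2)"
    by (rule Bochner_Integration.integrable_add)
  have "norm (u x) \<le> 1 + (norm (u x))\<^sup>2" for x
    by (rule le_1_plus_square)
  then show "AE x in lborel. norm (indicator S x *\<^sub>R u x) \<le> norm (indicator S x + (norm (u x))\<^sup>2)"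
    by (intro AE_I2) (simp split: split_indicator)
qed (use S in measurable)

lemma AE_not_in_frontier_box: "AE x in lborel. x \<notin> frontier (box l r :: 'a::euclidean_space set)"
proof -
  have "frontier (box l r :: 'a set) \<in> null_sets lebesgue"
    using negligible_convex_frontier[of "box l r :: 'a set"] by (simp add: negligible_iff_null_sets convex_box)
  then have "AE x in lebesgue. x \<notin> frontier (box l r :: 'a set)"
    by (rule AE_not_in)
  then show ?thesis
    by (simp add: AE_completion_iff)
qed

lemma indicator_tendsto_off_frontier:
  fixes x :: "'a::metric_space"
  assumes x: "x \<notin> frontier B" and y: "y \<longlonglongrightarrow> x"
  shows "(\<lambda>n. indicator B (y n) :: real) \<longlonglongrightarrow> indicator B x"
proof (cases "x \<in> interior B")
  case True
  have "\<forall>\<^sub>F n in sequentially. y n \<in> interior B"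
    using topological_tendstoD[OF y open_interior True] .
  then have "\<forall>\<^sub>F n in sequentially. indicator B (y n) = (indicator B x :: real)"
    by eventually_elim (use True interior_subset[of B] in \<open>simp add: indicator_def subset_iff\<close>)
  then show ?thesis by (rule tendsto_eventually)
next
  case False
  then have x: "x \<in> - closure B"
    using x by (simp add: frontier_def)
  have "\<forall>\<^sub>F n in sequentially. y n \<in> - closure B"
    using topological_tendstoD[OF y _ x] by auto
  then have "\<forall>\<^sub>F n in sequentially. indicator B (y n) = (indicator B x :: real)"
    by eventually_elim (use x closure_subset[of B] in \<open>auto simp: indicator_def\<close>)
  then show ?thesis by (rule tendsto_eventually)
qed

text \<open>The translation is moved from \<open>u\<close> to the indicator of the box, where it converges off the null set
  given by the boundary.\<close>

lemma box_integral_translate_tendsto: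
  fixes u :: "'a::euclidean_space \<Rightarrow> complex"
  assumes [measurable]: "u \<in> borel_measurable borel" and u: "square_integrable u"
    and v: "v \<longlonglongrightarrow> 0" and c: "\<And>n. norm (v n) \<le> c"
  shows "(\<lambda>n. \<integral>a. indicator (box l r) a *\<^sub>R u (a + v n) \<partial>lborel)
    \<longlonglongrightarrow> (\<integral>a. indicator (box l r) a *\<^sub>R u a \<partial>lborel)"
proof -
  let ?B = "box l r"
  obtain R where R: "\<And>x. x \<in> ?B \<Longrightarrow> norm x \<le> R"
    using bounded_box[of l r] by (auto simp: bounded_iff)
  have "(\<integral>a. indicator ?B a *\<^sub>R u (a + v n) \<partial>lborel) = (\<integral>x. indicator ?B (x - v n) *\<^sub>R u x \<partial>lborel)" for n
    by (subst integral_lborel_affine[of "\<lambda>x. indicator ?B (x - v n) *\<^sub>R u x" 1 "v n"])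
       (simp_all add: add.commute)
  moreover have "(\<lambda>n. \<integral>x. indicator ?B (x - v n) *\<^sub>R u x \<partial>lborel) \<longlonglongrightarrow> (\<integral>x. indicator ?B x *\<^sub>R u x \<partial>lborel)"
  proof (rule integral_dominated_convergence)
    show "integrable lborel (\<lambda>x. norm (indicator (cball 0 (R + c)) x *\<^sub>R u x))"
      by (intro integrable_norm set_integrable_of_square_integrable u) auto
    show "AE x in lborel. (\<lambda>n. indicator ?B (x - v n) *\<^sub>R u x) \<longlonglongrightarrow> indicator ?B x *\<^sub>R u x"
      using AE_not_in_frontier_box[of l r]
    proof eventually_elim
      case (elim x)
      have "(\<lambda>n. x - v n) \<longlonglongrightarrow> x"
        using tendsto_diff[OF tendsto_const v, of x] by simp
      then show ?case
        by (intro tendsto_intros indicator_tendsto_off_frontier elim)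
    qed
    show "AE x in lborel. norm (indicator ?B (x - v n) *\<^sub>R u x)
        \<le> norm (indicator (cball 0 (R + c)) x *\<^sub>R u x)" for n
    proof (rule AE_I2)
      fix x
      have "x \<in> cball 0 (R + c)" if "x - v n \<in> ?B"
        using R[OF that] c[of n] norm_triangle_ineq[of "x - v n" "v n"] by simp
      then show "norm (indicator ?B (x - v n) *\<^sub>R u x) \<le> norm (indicator (cball 0 (R + c)) x *\<^sub>R u x)"
        by (auto simp: indicator_def)
    qed
  qed simp_all
  ultimately show ?thesis by simp
qed

lemma box_integral_translate_bound:
  fixes u :: "'a::euclidean_space \<Rightarrow> complex"
  assumes [measurable]: "u \<in> borel_measurable borel" and u: "square_integrable u"
  obtains M where "M \<ge> 0"
    "\<And>v. (\<integral>\<^sup>+a. ennreal (norm (indicator (box l r) a *\<^sub>R u (a + v))) \<partial>lborel) \<le> ennreal M"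
proof
  define m where "m = measure lborel (box l r)"
  have m: "emeasure lborel (box l r) = ennreal m"
    unfolding m_def by (rule emeasure_eq_ennreal_measure) (use emeasure_lborel_box_finite[of l r] in simp)
  show "m + (l2_norm u)\<^sup>2 \<ge> 0"
    by (simp add: m_def)
  fix v
  have "norm (u x) \<le> 1 + (norm (u x))\<^sup>2" for x
    by (rule le_1_plus_square)
  then have "(\<integral>\<^sup>+a. ennreal (norm (indicator (box l r) a *\<^sub>R u (a + v))) \<partial>lborel)
      \<le> (\<integral>\<^sup>+a. indicator (box l r) a + ennreal ((norm (u (a + v)))\<^sup>2) \<partial>lborel)"
    by (intro nn_integral_mono) (auto split: split_indicator simp flip: ennreal_1 ennreal_plus intro!: ennreal_leI)
  also have "\<dots> = ennreal m + (\<integral>\<^sup>+a. ennreal ((norm (u (a - (- v))))\<^sup>2) \<partial>lborel)"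
    by (subst nn_integral_add) (simp_all add: m)
  also have "(\<integral>\<^sup>+a. ennreal ((norm (u (a - (- v))))\<^sup>2) \<partial>lborel) = (\<integral>\<^sup>+a. ennreal ((norm (u a))\<^sup>2) \<partial>lborel)"
    by (rule nn_integral_lborel_translate) measurable
  also have "\<dots> = ennreal ((l2_norm u)\<^sup>2)"
    using nn_integral_square_norm[OF u] by (simp add: nn_integral_completion)
  finally show "(\<integral>\<^sup>+a. ennreal (norm (indicator (box l r) a *\<^sub>R u (a + v))) \<partial>lborel)
      \<le> ennreal (m + (l2_norm u)\<^sup>2)"
    by (simp add: m_def)
qed

text \<open>By Fubini's theorem the integral over the box of the Gaussian average of \<open>u\<close> at scale \<open>1/(n+1)\<close>
  is the Gaussian mean of the integrals of \<open>u\<close> over slightly translated boxes. These are bounded and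
  converge to the integral over the box itself.\<close>

lemma box_integral_mollified_tendsto:
  fixes u :: "'a::euclidean_space \<Rightarrow> complex"
  assumes [measurable]: "u \<in> borel_measurable borel" and u: "square_integrable u"
  shows "(\<lambda>n. \<integral>a. indicator (box l r) a *\<^sub>R
            (\<integral>z. u (a + (1 / real (Suc n)) *\<^sub>R z) * of_real (gaussian z) \<partial>lborel) \<partial>lborel)
    \<longlonglongrightarrow> (\<integral>a. indicator (box l r) a *\<^sub>R u a \<partial>lborel)"
proof -
  define B where "B = box l r"
  have [measurable]: "B \<in> sets borel"
    by (simp add: B_def)
  define s where "s n = 1 / real (Suc n)" for n
  have s: "0 < s n" "s n \<le> 1" for n
    by (simp_all add: s_def)
  have s_lim: "s \<longlonglongrightarrow> 0"
    using LIMSEQ_inverse_real_of_nat by (simp add: s_def[abs_def] inverse_eq_divide)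
  obtain M where M: "M \<ge> 0"
    "\<And>v. (\<integral>\<^sup>+a. ennreal (norm (indicator B a *\<^sub>R u (a + v))) \<partial>lborel) \<le> ennreal M"
    using box_integral_translate_bound[OF assms, of l r] unfolding B_def by blast
  define U where "U v = (\<integral>a. indicator B a *\<^sub>R u (a + v) \<partial>lborel)" for v
  have [measurable]: "U \<in> borel_measurable borel"
    unfolding U_def by measurable
  have U_le: "norm (U v) \<le> M" for v
  proof (cases "integrable lborel (\<lambda>a. indicator B a *\<^sub>R u (a + v))")
    case True
    have "ennreal (norm (U v)) \<le> ennreal M"
      unfolding U_def using integral_norm_bound_ennreal[OF True] M(2)[of v] by (rule order_trans)
    then show ?thesis using M(1) by simp
  qed (use M(1) in \<open>simp add: U_def not_integrable_integral_eq\<close>)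
  have swap: "(\<integral>a. indicator B a *\<^sub>R (\<integral>z. u (a + s n *\<^sub>R z) * of_real (gaussian z) \<partial>lborel) \<partial>lborel)
      = (\<integral>z. of_real (gaussian z) * U (s n *\<^sub>R z) \<partial>lborel)" for n
  proof -
    define k where "k z a = of_real (gaussian z) * (indicator B a *\<^sub>R u (a + s n *\<^sub>R z))" for z a
    have [measurable]: "(\<lambda>(z, a). k z a) \<in> borel_measurable (lborel \<Otimes>\<^sub>M lborel)"
      unfolding k_def by measurable
    have "integrable (lborel \<Otimes>\<^sub>M lborel) (\<lambda>(z, a). k z a)"
    proof (rule integrableI_bounded)
      have "(\<integral>\<^sup>+p. ennreal (norm (case p of (z, a) \<Rightarrow> k z a)) \<partial>(lborel \<Otimes>\<^sub>M lborel))
          = (\<integral>\<^sup>+z. \<integral>\<^sup>+a. ennreal (norm (k z a)) \<partial>lborel \<partial>lborel)"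
        by (subst lborel.nn_integral_fst[symmetric]) auto
      also have "\<dots> = (\<integral>\<^sup>+z. ennreal (gaussian z) *
          (\<integral>\<^sup>+a. ennreal (norm (indicator B a *\<^sub>R u (a + s n *\<^sub>R z))) \<partial>lborel) \<partial>lborel)"
        unfolding k_def norm_mult by (simp add: ennreal_mult nn_integral_cmult less_imp_le)
      also have "\<dots> \<le> (\<integral>\<^sup>+z. ennreal (gaussian (z::'a)) * ennreal M \<partial>lborel)"
      proof (rule nn_integral_mono)
        fix z :: 'a
        show "ennreal (gaussian z) * (\<integral>\<^sup>+a. ennreal (norm (indicator B a *\<^sub>R u (a + s n *\<^sub>R z))) \<partial>lborel)
            \<le> ennreal (gaussian z) * ennreal M"
          by (rule mult_left_mono[OF M(2)]) simp
      qed
      also have "\<dots> < \<infinity>"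
        using integrable_gaussian[where 'a = 'a]
        by (simp add: nn_integral_multc integrable_iff_bounded ennreal_mult_less_top less_imp_le)
      finally show "(\<integral>\<^sup>+p. ennreal (norm (case p of (z, a) \<Rightarrow> k z a)) \<partial>(lborel \<Otimes>\<^sub>M lborel)) < \<infinity>" .
    qed simp
    note Fub = lborel_pair.Fubini_integral[OF this]
    have "indicator B a *\<^sub>R (\<integral>z. u (a + s n *\<^sub>R z) * of_real (gaussian z) \<partial>lborel) = (\<integral>z. k z a \<partial>lborel)" for a
    proof -
      have "(\<integral>z. k z a \<partial>lborel) = (\<integral>z. indicator B a *\<^sub>R (u (a + s n *\<^sub>R z) * of_real (gaussian z)) \<partial>lborel)"
        by (intro Bochner_Integration.integral_cong) (simp_all add: k_def mult.commute)
      then show ?thesis by simp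
    qed
    then have "(\<integral>a. indicator B a *\<^sub>R (\<integral>z. u (a + s n *\<^sub>R z) * of_real (gaussian z) \<partial>lborel) \<partial>lborel)
        = (\<integral>a. \<integral>z. k z a \<partial>lborel \<partial>lborel)"
      by simp
    also have "\<dots> = (\<integral>z. \<integral>a. k z a \<partial>lborel \<partial>lborel)"
      by (rule Fub)
    also have "\<dots> = (\<integral>z. of_real (gaussian z) * U (s n *\<^sub>R z) \<partial>lborel)"
      by (simp only: k_def U_def integral_mult_right_zero)
    finally show ?thesis .
  qed
  have "(\<lambda>n. \<integral>z. of_real (gaussian z) * U (s n *\<^sub>R z) \<partial>lborel) \<longlonglongrightarrow> (\<integral>z. of_real (gaussian (z::'a)) * U 0 \<partial>lborel)"
  proof (rule integral_dominated_convergence)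
    show "integrable lborel (\<lambda>z::'a. gaussian z * M)"
      by (intro integrable_mult_left integrable_gaussian)
    show "AE z in lborel. norm (of_real (gaussian z) * U (s n *\<^sub>R z)) \<le> gaussian z * M" for n
      using U_le by (intro AE_I2) (simp add: norm_mult less_imp_le mult_left_mono)
    show "AE z in lborel. (\<lambda>n. of_real (gaussian z) * U (s n *\<^sub>R z)) \<longlonglongrightarrow> of_real (gaussian z) * U 0"
    proof (intro AE_I2 tendsto_mult tendsto_const)
      fix z :: 'a
      have "(\<lambda>n. s n *\<^sub>R z) \<longlonglongrightarrow> 0"
        using tendsto_scaleR[OF s_lim tendsto_const[of z]] by simp
      moreover have "norm (s n *\<^sub>R z) \<le> norm z" for n
        using s[of n] by (simp add: mult_left_le_one_le)
      ultimately show "(\<lambda>n. U (s n *\<^sub>R z)) \<longlonglongrightarrow> U 0"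
        using box_integral_translate_tendsto[OF assms, of "\<lambda>n. s n *\<^sub>R z" "norm z" l r]
        by (simp add: U_def B_def)
    qed
  qed simp_all
  then have "(\<lambda>n. \<integral>z. of_real (gaussian z) * U (s n *\<^sub>R z) \<partial>lborel) \<longlonglongrightarrow> U 0"
    by (simp add: integral_gaussian)
  then show ?thesis
    unfolding swap[symmetric] by (simp add: U_def B_def s_def)
qed

text \<open>The limit and the function have the same integral over every box. A constant bound suffices as
  boxes have finite measure.\<close>

lemma AE_eq_mollification_limit:
  fixes u h :: "'a::euclidean_space \<Rightarrow> complex"
  assumes [measurable]: "u \<in> borel_measurable borel" and u: "square_integrable u"
    and lim: "\<And>a. (\<lambda>n. \<integral>z. u (a + (1 / real (Suc n)) *\<^sub>R z) * of_real (gaussian z) \<partial>lborel) \<longlonglongrightarrow> h a"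
    and bound: "\<And>a n. norm (\<integral>z. u (a + (1 / real (Suc n)) *\<^sub>R z) * of_real (gaussian z) \<partial>lborel) \<le> K"
  shows "AE x in lborel. u x = h x"
proof -
  define m where "m n a = (\<integral>z. u (a + (1 / real (Suc n)) *\<^sub>R z) * of_real (gaussian z) \<partial>lborel)" for n a
  have [measurable]: "m n \<in> borel_measurable borel" for n
    unfolding m_def by measurable
  have [measurable]: "h \<in> borel_measurable borel"
    by (rule borel_measurable_LIMSEQ_metric[of m]) (use lim in \<open>simp_all add: m_def\<close>)
  have "norm (h a) \<le> K" for a
    by (rule LIMSEQ_le_const2[OF tendsto_norm[OF lim[of a]]]) (use bound in blast)
  have intB: "integrable lborel (\<lambda>x. indicator (box l r) x * K)" for l r :: 'a
    using emeasure_lborel_box_finite[of l r]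
    by (intro integrable_mult_left) (simp add: integrable_indicator_iff less_top)
  have inth: "integrable lborel (\<lambda>x. indicator (box l r) x *\<^sub>R h x)" for l r
    by (rule Bochner_Integration.integrable_bound[OF intB[of l r]])
       (use \<open>\<And>a. norm (h a) \<le> K\<close> in \<open>auto split: split_indicator intro: order_trans[OF _ abs_ge_self]\<close>)
  have intu: "integrable lborel (\<lambda>x. indicator (box l r) x *\<^sub>R u x)" for l r
    by (rule set_integrable_of_square_integrable[OF _ u]) auto
  have "(\<integral>x. indicator (box l r) x *\<^sub>R u x \<partial>lborel) = (\<integral>x. indicator (box l r) x *\<^sub>R h x \<partial>lborel)" for l r
  proof (rule LIMSEQ_unique)
    show "(\<lambda>n. \<integral>a. indicator (box l r) a *\<^sub>R m n a \<partial>lborel) \<longlonglongrightarrow> (\<integral>x. indicator (box l r) x *\<^sub>R u x \<partial>lborel)"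
      unfolding m_def by (rule box_integral_mollified_tendsto[OF _ u]) simp
    show "(\<lambda>n. \<integral>a. indicator (box l r) a *\<^sub>R m n a \<partial>lborel) \<longlonglongrightarrow> (\<integral>x. indicator (box l r) x *\<^sub>R h x \<partial>lborel)"
    proof (rule integral_dominated_convergence[OF _ _ intB[of l r]])
      show "AE x in lborel. (\<lambda>n. indicator (box l r) x *\<^sub>R m n x) \<longlonglongrightarrow> indicator (box l r) x *\<^sub>R h x"
        unfolding m_def by (intro AE_I2 tendsto_intros lim)
      show "AE x in lborel. norm (indicator (box l r) x *\<^sub>R m n x) \<le> indicator (box l r) x * K" for n
        using bound by (intro AE_I2) (simp add: m_def split: split_indicator)
    qed simp_all
  qed
  then have "AE x in lborel. u x - h x = 0"
    by (intro AE_eq_0_if_box_integrals_0) (simp_all add: scaleR_diff_right intu inth)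
  then show ?thesis by simp
qed

section \<open>Uniqueness and inversion of the Fourier transform\<close>

text \<open>The Gaussian average of \<open>G\<close> around \<open>a\<close> pairs \<open>G\<close> with a Gaussian kernel, and therefore depends on \<open>F\<close>
  only. So the Gaussian averages of \<open>G - G'\<close> all vanish.\<close>

lemma has_fourier_L2_unique:
  fixes F G G' :: "'a::euclidean_space ae_fun"
  assumes G: "has_fourier_L2 F G" and G': "has_fourier_L2 F G'"
  shows "G = G'"
proof -
  obtain g where g: "g \<in> borel_measurable borel" "G = ae_class g" "AE x in lebesgue. repr G x = g x"
    by (rule ae_fun_cases)
  obtain g' where g': "g' \<in> borel_measurable borel" "G' = ae_class g'" "AE x in lebesgue. repr G' x = g' x"
    by (rule ae_fun_cases)
  note [measurable] = g(1) g'(1)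
  have meas [measurable]: "g \<in> borel_measurable lebesgue" "g' \<in> borel_measurable lebesgue"
    by (simp_all add: measurable_completion)
  have sq: "square_integrable g" "square_integrable g'"
    using G G' square_integrable_cong_AE[OF g(3)] square_integrable_cong_AE[OF g'(3)]
    by (simp_all add: has_fourier_L2_def)
  have "(\<integral>z. (g (a + s *\<^sub>R z) - g' (a + s *\<^sub>R z)) * of_real (gaussian z) \<partial>lborel) = 0" if s: "s > 0" for a :: 'a and s
  proof -
    have int: "integrable lborel (\<lambda>x. u x * gaussian_kernel s a x)"
      if "square_integrable u" and [measurable]: "u \<in> borel_measurable borel" for u :: "'a \<Rightarrow> complex"
    proof -
      have "integrable lebesgue (\<lambda>x. norm (u x) * norm (gaussian_kernel s a x))"
        by (rule square_integrable_mult(1)[OF that(1) gaussian_kernel_integrable(2)[OF s]])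
      then have "integrable lborel (\<lambda>x. norm (u x * gaussian_kernel s a x))"
        by (subst (asm) integrable_completion) (simp_all add: norm_mult)
      then show ?thesis
        by (rule integrable_norm_cancel) measurable
    qed
    have pairing: "(\<integral>x. g x * gaussian_kernel s a x \<partial>lborel)
        = (\<integral>x. repr F x * fourier_L1 (gaussian_kernel s a) x \<partial>lebesgue)"
      if "has_fourier_L2 F H" "AE x in lebesgue. repr H x = g x" and [measurable]: "g \<in> borel_measurable borel" for g H
    proof -
      have "(\<integral>x. g x * gaussian_kernel s a x \<partial>lborel) = (\<integral>x. g x * gaussian_kernel s a x \<partial>lebesgue)"
        by (rule integral_completion[symmetric]) measurable
      also have "\<dots> = (\<integral>x. repr H x * gaussian_kernel s a x \<partial>lebesgue)"
        by (rule integral_lebesgue_cong_AE, use that(2) in eventually_elim) simp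
      also have "\<dots> = (\<integral>x. repr F x * fourier_L1 (gaussian_kernel s a) x \<partial>lebesgue)"
        by (rule has_fourier_L2_pairing[OF that(1) gaussian_kernel_integrable[OF s]
              square_integrable_fourier_gaussian_kernel[OF s]])
      finally show ?thesis .
    qed
    have "(\<integral>z. (g (a + s *\<^sub>R z) - g' (a + s *\<^sub>R z)) * of_real (gaussian z) \<partial>lborel)
        = (\<integral>x. (g x - g' x) * gaussian_kernel s a x \<partial>lborel)"
      by (rule integral_gaussian_kernel[OF _ s, symmetric]) measurable
    also have "\<dots> = 0"
      using int[OF sq(1)] int[OF sq(2)] pairing[OF G g(3)] pairing[OF G' g'(3)]
      by (simp add: left_diff_distrib)
    finally show ?thesis .
  qed
  (* With limit function and bound both 0. *)
  then have "AE x in lborel. g x - g' x = 0"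
    by (intro AE_eq_mollification_limit[where K = 0] square_integrable_diff sq) simp_all
  then have "AE x in lebesgue. g x - g' x = 0"
    by (rule AE_completion)
  then show ?thesis
    unfolding g(2) g'(2) by (intro ae_class_eq meas) simp
qed

lemma fourier_L2_eq: "has_fourier_L2 F G \<Longrightarrow> fourier_L2 F = G"
  unfolding fourier_L2_def by (rule the_equality) (auto intro: has_fourier_L2_unique)

lemma norm_fourier_L1_le: "norm (fourier_L1 f \<xi>) \<le> (\<integral>x. norm (f x) \<partial>lebesgue)"
  using integral_norm_bound[of lebesgue "\<lambda>t. f t * cis (- (2 * pi * (\<xi> \<bullet> t)))"]
  by (simp add: fourier_L1_cis norm_mult)

text \<open>The Gaussian average of \<open>F\<close> around \<open>a\<close> is the pairing of \<open>G\<close> with a damped plane wave of frequency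
  \<open>a\<close>. As the damping disappears, this tends to the inverse transform of \<open>G\<close> at \<open>a\<close>, which is the
  transform of \<open>G\<close> at \<open>- a\<close>.\<close>

lemma fourier_L2_inversion:
  fixes F G :: "'a::euclidean_space ae_fun"
  assumes FG: "has_fourier_L2 F G" and int: "integrable lebesgue (repr G)"
  shows "AE x in lebesgue. repr F x = fourier_L1 (repr G) (- x)"
proof -
  obtain f where f: "f \<in> borel_measurable borel" "F = ae_class f" "AE x in lebesgue. repr F x = f x"
    by (rule ae_fun_cases)
  note [measurable] = f(1)
  have [measurable]: "f \<in> borel_measurable lebesgue"
    by (simp add: measurable_completion)
  have sq: "square_integrable f"
    using FG square_integrable_cong_AE[OF f(3)] by (simp add: has_fourier_L2_def)
  have wave: "(\<integral>z. f (a + s *\<^sub>R z) * of_real (gaussian z) \<partial>lborel) = (\<integral>\<xi>. repr G \<xi> * gaussian_wave s a \<xi> \<partial>lebesgue)"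
    if s: "s > 0" for a :: 'a and s
  proof -
    have "(\<integral>z. f (a + s *\<^sub>R z) * of_real (gaussian z) \<partial>lborel) = (\<integral>x. f x * gaussian_kernel s a x \<partial>lborel)"
      by (rule integral_gaussian_kernel[OF _ s, symmetric]) measurable
    also have "\<dots> = (\<integral>x. f x * gaussian_kernel s a x \<partial>lebesgue)"
      by (rule integral_completion[symmetric]) measurable
    also have "\<dots> = (\<integral>x. repr F x * fourier_L1 (gaussian_wave s a) x \<partial>lebesgue)"
      unfolding fourier_gaussian_wave[OF s]
      by (rule integral_lebesgue_cong_AE, use f(3) in eventually_elim) simp
    also have "\<dots> = (\<integral>\<xi>. repr G \<xi> * gaussian_wave s a \<xi> \<partial>lebesgue)"
      by (rule has_fourier_L2_pairing[OF FG gaussian_wave_integrable[OF s], symmetric])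
         (simp add: fourier_gaussian_wave[OF s] gaussian_kernel_integrable[OF s])
    finally show ?thesis .
  qed
  have cis_meas [measurable]: "(\<lambda>t :: 'a. cis (- (2 * pi * (\<xi> \<bullet> t)))) \<in> borel_measurable lebesgue" for \<xi>
    by (rule measurable_completion) measurable
  have [measurable]: "gaussian_wave s a \<in> borel_measurable lebesgue" for s and a :: 'a
    by (rule measurable_completion) simp
  have wave_le: "norm (gaussian_wave s a \<xi>) \<le> 1" for s \<xi> and a :: 'a
    by (simp add: gaussian_wave_def norm_mult gaussian_le_1 less_imp_le)
  have "AE x in lborel. f x = fourier_L1 (repr G) (- x)"
  proof (rule AE_eq_mollification_limit[OF _ sq])
    fix a :: 'a
    show "(\<lambda>n. \<integral>z. f (a + (1 / real (Suc n)) *\<^sub>R z) * of_real (gaussian z) \<partial>lborel) \<longlonglongrightarrow> fourier_L1 (repr G) (- a)"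
      unfolding wave[OF divide_pos_pos[OF zero_less_one of_nat_0_less_iff[THEN iffD2, OF zero_less_Suc]]] fourier_L1_cis
    proof (rule integral_dominated_convergence)
      show "integrable lebesgue (\<lambda>\<xi>. norm (repr G \<xi>))"
        using int by (rule integrable_norm)
      show "AE \<xi> in lebesgue. norm (repr G \<xi> * gaussian_wave (1 / real (Suc n)) a \<xi>) \<le> norm (repr G \<xi>)" for n
        using wave_le by (intro AE_I2) (simp add: norm_mult mult_left_le)
      show "AE \<xi> in lebesgue. (\<lambda>n. repr G \<xi> * gaussian_wave (1 / real (Suc n)) a \<xi>)
          \<longlonglongrightarrow> repr G \<xi> * cis (- (2 * pi * (- a \<bullet> \<xi>)))"
      proof (intro AE_I2 tendsto_mult tendsto_const)
        fix \<xi> :: 'a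
        have "(\<lambda>n. (1 / real (Suc n)) *\<^sub>R \<xi>) \<longlonglongrightarrow> 0 *\<^sub>R \<xi>"
          using LIMSEQ_inverse_real_of_nat by (intro tendsto_scaleR tendsto_const) (simp add: inverse_eq_divide)
        moreover have "isCont gaussian (0 *\<^sub>R \<xi>)"
          unfolding gaussian_def by (intro continuous_intros)
        ultimately have "(\<lambda>n. gaussian ((1 / real (Suc n)) *\<^sub>R \<xi>)) \<longlonglongrightarrow> gaussian (0 *\<^sub>R \<xi>)"
          by (rule isCont_tendsto_compose[rotated])
        then have "(\<lambda>n. complex_of_real (gaussian ((1 / real (Suc n)) *\<^sub>R \<xi>)) * cis (2 * pi * (a \<bullet> \<xi>)))
            \<longlonglongrightarrow> of_real (gaussian (0 *\<^sub>R \<xi>)) * cis (2 * pi * (a \<bullet> \<xi>))"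
          by (intro tendsto_intros)
        then show "(\<lambda>n. gaussian_wave (1 / real (Suc n)) a \<xi>) \<longlonglongrightarrow> cis (- (2 * pi * (- a \<bullet> \<xi>)))"
          by (simp add: gaussian_wave_def[abs_def] gaussian_def)
      qed
      show "(\<lambda>t. repr G t * cis (- (2 * pi * (- a \<bullet> t)))) \<in> borel_measurable lebesgue"
        by measurable
      show "(\<lambda>\<xi>. repr G \<xi> * gaussian_wave (1 / real (Suc n)) a \<xi>) \<in> borel_measurable lebesgue" for n
        by measurable
    qed
    show "norm (\<integral>z. f (a + (1 / real (Suc n)) *\<^sub>R z) * of_real (gaussian z) \<partial>lborel)
        \<le> (\<integral>\<xi>. norm (repr G \<xi>) \<partial>lebesgue)" for n
    proof -
      have "norm (\<integral>\<xi>. repr G \<xi> * gaussian_wave (1 / real (Suc n)) a \<xi> \<partial>lebesgue)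
          \<le> (\<integral>\<xi>. norm (repr G \<xi> * gaussian_wave (1 / real (Suc n)) a \<xi>) \<partial>lebesgue)"
        by (rule integral_norm_bound)
      also have "\<dots> \<le> (\<integral>\<xi>. norm (repr G \<xi>) \<partial>lebesgue)"
        using wave_le int by (intro integral_mono') (simp_all add: norm_mult mult_left_le)
      finally show ?thesis
        by (subst wave) simp_all
    qed
  qed simp
  then have "AE x in lebesgue. f x = fourier_L1 (repr G) (- x)"
    by (rule AE_completion)
  with f(3) show ?thesis
    by eventually_elim simp
qed

section \<open>Sobolev embedding\<close>

lemma uniformly_continuous_fourier_L1:
  fixes f :: "'a::euclidean_space \<Rightarrow> complex"
  assumes f: "integrable lebesgue f"
  shows "uniformly_continuous_on UNIV (fourier_L1 f)"
  unfolding uniformly_continuous_on_sequentially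
proof (intro allI impI, elim conjE)
  fix x y :: "nat \<Rightarrow> 'a"
  assume lim: "(\<lambda>n. dist (x n) (y n)) \<longlonglongrightarrow> 0"
  have [measurable]: "f \<in> borel_measurable lebesgue"
    using f by auto
  have [measurable]: "(\<lambda>t :: 'a. cis (- (2 * pi * (\<xi> \<bullet> t)))) \<in> borel_measurable lebesgue" for \<xi>
    by (rule measurable_completion) measurable
  have int: "integrable lebesgue (\<lambda>t. f t * cis (- (2 * pi * (\<xi> \<bullet> t))))" for \<xi>
    by (rule Bochner_Integration.integrable_bound[OF f]) (simp_all add: norm_mult)
  have cis_diff: "norm (cis a - cis b) = norm (cis (a - b) - 1)" for a b
  proof -
    have "cis a - cis b = cis b * (cis (a - b) - 1)"
      by (simp add: algebra_simps cis_mult)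
    then show ?thesis by (simp add: norm_mult)
  qed
  define \<omega> where "\<omega> n = (\<integral>t. norm (f t) * norm (cis (- (2 * pi * ((x n - y n) \<bullet> t))) - 1) \<partial>lebesgue)" for n
  have dist_le: "dist (fourier_L1 f (x n)) (fourier_L1 f (y n)) \<le> \<omega> n" for n
  proof -
    have "fourier_L1 f (x n) - fourier_L1 f (y n)
        = (\<integral>t. f t * (cis (- (2 * pi * (x n \<bullet> t))) - cis (- (2 * pi * (y n \<bullet> t)))) \<partial>lebesgue)"
      unfolding fourier_L1_cis using int[of "x n"] int[of "y n"] by (simp add: right_diff_distrib)
    also have "norm \<dots> \<le> (\<integral>t. norm (f t * (cis (- (2 * pi * (x n \<bullet> t))) - cis (- (2 * pi * (y n \<bullet> t))))) \<partial>lebesgue)"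
      by (rule integral_norm_bound)
    also have "\<dots> = \<omega> n"
      unfolding \<omega>_def norm_mult cis_diff by (simp add: algebra_simps)
    finally show ?thesis by (simp add: dist_norm)
  qed
  have "\<omega> \<longlonglongrightarrow> (\<integral>t. 0 \<partial>(lebesgue :: 'a measure))"
    unfolding \<omega>_def
  proof (rule integral_dominated_convergence)
    show "integrable lebesgue (\<lambda>t. norm (f t) * 2)"
      using f by simp
    show "AE t in lebesgue. norm (norm (f t) * norm (cis (- (2 * pi * ((x n - y n) \<bullet> t))) - 1)) \<le> norm (f t) * 2" for n
    proof (rule AE_I2)
      fix t
      have "norm (cis (- (2 * pi * ((x n - y n) \<bullet> t))) - 1) \<le> 2"
        using norm_triangle_ineq4[of "cis (- (2 * pi * ((x n - y n) \<bullet> t)))" 1] by simp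
      then show "norm (norm (f t) * norm (cis (- (2 * pi * ((x n - y n) \<bullet> t))) - 1)) \<le> norm (f t) * 2"
        by (simp add: mult_left_mono)
    qed
    show "AE t in lebesgue. (\<lambda>n. norm (f t) * norm (cis (- (2 * pi * ((x n - y n) \<bullet> t))) - 1)) \<longlonglongrightarrow> 0"
    proof (intro AE_I2 tendsto_mult_right_zero)
      fix t
      have "(\<lambda>n. x n - y n) \<longlonglongrightarrow> 0"
        using lim by (simp add: dist_norm tendsto_norm_zero_iff)
      then have "(\<lambda>n. norm (cis (- (2 * pi * ((x n - y n) \<bullet> t))) - 1)) \<longlonglongrightarrow> norm (cis (- (2 * pi * (0 \<bullet> t))) - 1)"
        by (intro tendsto_intros)
      then show "(\<lambda>n. norm (cis (- (2 * pi * ((x n - y n) \<bullet> t))) - 1)) \<longlonglongrightarrow> 0"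
        by simp
    qed
  qed simp_all
  then have \<omega>: "\<omega> \<longlonglongrightarrow> 0"
    by simp
  show "(\<lambda>n. dist (fourier_L1 f (x n)) (fourier_L1 f (y n))) \<longlonglongrightarrow> 0"
    by (rule tendsto_sandwich[OF _ _ tendsto_const \<omega>]) (auto intro: always_eventually dist_le)
qed

text \<open>Otherwise \<open>h\<close> exceeds a fixed positive bound on balls of a fixed radius arbitrarily far out. Those
  balls contribute a fixed amount to the integral of \<open>|h|\<^sup>2\<close>, whereas the contribution of balls
  escaping to infinity tends to 0.\<close>

lemma uniformly_continuous_square_integrable_vanishes:
  fixes h :: "'a::euclidean_space \<Rightarrow> complex"
  assumes uc: "uniformly_continuous_on UNIV h" and sq: "square_integrable h"
  shows "(h \<longlongrightarrow> 0) at_infinity"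
proof (rule ccontr)
  assume "\<not> (h \<longlongrightarrow> 0) at_infinity"
  then obtain e where e: "e > 0" "\<And>b. \<exists>x. norm x \<ge> b \<and> norm (h x) \<ge> e"
    unfolding Lim_at_infinity by (auto simp: not_less)
  have "\<forall>n. \<exists>x. norm x \<ge> real n \<and> norm (h x) \<ge> e"
    using e(2) by blast
  then obtain x where x: "\<And>n. norm (x n) \<ge> real n" "\<And>n. norm (h (x n)) \<ge> e"
    by metis
  obtain d where d: "d > 0" "\<And>x y. dist x y < d \<Longrightarrow> dist (h x) (h y) < e / 2"
    using uc e(1) unfolding uniformly_continuous_on_def by (metis UNIV_I half_gt_zero)
  have int: "integrable lebesgue (\<lambda>y. (norm (h y))\<^sup>2)"
    using sq by (simp add: square_integrable_def)
  have [measurable]: "h \<in> borel_measurable lebesgue"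
    using sq by (simp add: square_integrable_def)
  have [measurable]: "ball z d \<in> sets lebesgue" for z :: 'a
    by (rule fmeasurableD[OF lmeasurable_ball])
  have "(\<lambda>n. \<integral>y. indicator (ball (x n) d) y * (norm (h y))\<^sup>2 \<partial>lebesgue) \<longlonglongrightarrow> (\<integral>y. 0 \<partial>(lebesgue :: 'a measure))"
  proof (rule integral_dominated_convergence[OF _ _ int])
    show "AE y in lebesgue. (\<lambda>n. indicator (ball (x n) d) y * (norm (h y))\<^sup>2) \<longlonglongrightarrow> 0"
    proof (rule AE_I2)
      fix y :: 'a
      obtain N :: nat where N: "norm y + d < real N"
        using reals_Archimedean2 by blast
      have "y \<notin> ball (x n) d" if "n \<ge> N" for n
        using x(1)[of n] N that norm_triangle_ineq4[of "x n" y] norm_triangle_sub[of "x n" y]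
        by (simp add: dist_norm)
      then have "\<forall>\<^sub>F n in sequentially. indicator (ball (x n) d) y * (norm (h y))\<^sup>2 = 0"
        by (intro eventually_sequentiallyI[of N]) simp
      then show "(\<lambda>n. indicator (ball (x n) d) y * (norm (h y))\<^sup>2) \<longlonglongrightarrow> 0"
        by (rule tendsto_eventually)
    qed
    show "AE y in lebesgue. norm (indicator (ball (x n) d) y * (norm (h y))\<^sup>2) \<le> (norm (h y))\<^sup>2" for n
      by (intro AE_I2) (simp split: split_indicator)
  qed simp_all
  then have lim: "(\<lambda>n. \<integral>y. indicator (ball (x n) d) y * (norm (h y))\<^sup>2 \<partial>lebesgue) \<longlonglongrightarrow> 0"
    by simp
  define c where "c = (e / 2)\<^sup>2 * (d ^ DIM('a) * measure lebesgue (ball 0 1 :: 'a set))"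
  have "c \<le> (\<integral>y. indicator (ball (x n) d) y * (norm (h y))\<^sup>2 \<partial>lebesgue)" for n
  proof -
    have "c = (e / 2)\<^sup>2 * measure lebesgue (ball (x n) d)"
      using d(1) content_ball_conv_unit_ball[of d "x n"] by (simp add: c_def)
    also have "\<dots> = (\<integral>y. indicator (ball (x n) d) y * (e / 2)\<^sup>2 \<partial>lebesgue)"
      by simp
    also have "\<dots> \<le> (\<integral>y. indicator (ball (x n) d) y * (norm (h y))\<^sup>2 \<partial>lebesgue)"
    proof (rule integral_mono)
      show "integrable lebesgue (\<lambda>y. indicator (ball (x n) d) y * (e / 2)\<^sup>2)"
        using emeasure_bounded_finite[OF bounded_ball[of "x n" d]]
        by (intro integrable_mult_left) (simp add: integrable_indicator_iff)
      show "integrable lebesgue (\<lambda>y. indicator (ball (x n) d) y * (norm (h y))\<^sup>2)"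
        by (rule Bochner_Integration.integrable_bound[OF int]) (auto split: split_indicator)
      fix y
      have "(e / 2)\<^sup>2 \<le> (norm (h y))\<^sup>2" if "y \<in> ball (x n) d"
      proof (rule power_mono)
        have "norm (h (x n)) - norm (h y) < e / 2"
          using d(2)[of "x n" y] that norm_triangle_ineq2[of "h (x n)" "h y"] by (simp add: dist_norm)
        with x(2)[of n] show "e / 2 \<le> norm (h y)" by linarith
      qed (use e in simp)
      then show "indicator (ball (x n) d) y * (e / 2)\<^sup>2 \<le> indicator (ball (x n) d) y * (norm (h y))\<^sup>2"
        by (simp split: split_indicator)
    qed
    finally show ?thesis .
  qed
  then have "c \<le> 0"
    using lim by (intro LIMSEQ_le_const) auto
  moreover have "c > 0"
    using e(1) d(1) content_ball_pos[of 1 "0 :: 'a"] by (simp add: c_def)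
  ultimately show False by simp
qed

lemma sobolev_weight: "weight (sobolev_weight s :: 'a::euclidean_space \<Rightarrow> real)"
proof -
  have "sobolev_weight s \<in> borel_measurable (borel :: 'a measure)"
    unfolding sobolev_weight_def by measurable
  moreover have "sobolev_weight s x > 0" for x :: 'a
    unfolding sobolev_weight_def by (simp add: add_pos_nonneg less_imp_neq[symmetric])
  ultimately show ?thesis
    by (simp add: weight_def measurable_completion)
qed

lemma C0_eq_if_ae_class_eq:
  fixes h h' :: "'a::euclidean_space \<Rightarrow> complex"
  assumes h: "h \<in> C0" and h': "h' \<in> C0" and eq: "ae_class h = ae_class h'"
  shows "h = h'"
proof
  fix x
  have cont: "continuous_on UNIV h" "continuous_on UNIV h'"
    using h h' by (auto simp: C0_def)
  then have meas: "h \<in> borel_measurable lebesgue" "h' \<in> borel_measurable lebesgue"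
    by (auto intro!: measurable_completion borel_measurable_continuous_onI)
  have "AE x in lebesgue. x \<in> {x. h x = h' x}"
    using AE_repr_ae_class[OF meas(1)] AE_repr_ae_class[OF meas(2)] unfolding eq
    by eventually_elim simp
  moreover have "closed {x. h x = h' x}"
    using cont by (intro closed_Collect_eq)
  ultimately have "x \<in> {x. h x = h' x}"
    by (intro mem_closed_if_AE_lebesgue)
  then show "h x = h' x" by simp
qed

text \<open>The witness is the inverse transform of \<open>G\<close>, and the embedding constant is \<open>\<parallel>1/v\<^sub>s\<parallel>\<^sub>2\<close>.\<close>

theorem sobolev_embedding:
  assumes inv: "square_integrable (\<lambda>y :: 'a::euclidean_space. 1 / sobolev_weight s y)"
  shows "continuously_embedded_C0 (sobolev_space s :: 'a ae_fun set) (sobolev_norm s)"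
proof -
  let ?w = "sobolev_weight s :: 'a \<Rightarrow> real"
  define K where "K = l2_norm (\<lambda>y :: 'a. 1 / sobolev_weight s y)"
  have w: "?w \<in> borel_measurable lebesgue" "?w x > 0" for x
    using sobolev_weight[of s] by (auto simp: weight_def)
  have rep: "\<exists>h\<in>C0. ae_class h = F \<and> (\<forall>x. norm (h x) \<le> K * sobolev_norm s F)"
    if F: "F \<in> sobolev_space s" for F :: "'a ae_fun"
  proof -
    obtain G where G: "has_fourier_L2 F G" "G \<in> L2w ?w"
      using F by (auto simp: sobolev_space_def)
    note L1 = weighted_square_integrable_imp_integrable[OF w(2) inv borel_measurable_repr L2wD[OF G(2)]]
    define h where "h x = fourier_L1 (repr G) (- x)" for x
    have le: "norm (h x) \<le> K * sobolev_norm s F" for x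
      using norm_fourier_L1_le[of "repr G" "- x"] L1(2)
      by (simp add: h_def K_def sobolev_norm_def L2w_norm_def fourier_L2_eq[OF G(1)])
    have uc: "uniformly_continuous_on UNIV h"
      unfolding h_def
    proof (rule uniformly_continuous_on_compose[where g = uminus])
      show "uniformly_continuous_on UNIV (uminus :: 'a \<Rightarrow> 'a)"
        by (intro uniformly_continuous_on_minus uniformly_continuous_on_id)
      show "uniformly_continuous_on (range (uminus :: 'a \<Rightarrow> 'a)) (fourier_L1 (repr G))"
        using uniformly_continuous_fourier_L1[OF L1(1)] by (simp add: surjI[of uminus uminus])
    qed
    have meas: "h \<in> borel_measurable lebesgue"
      using uniformly_continuous_imp_continuous[OF uc]
      by (auto intro!: measurable_completion borel_measurable_continuous_onI)
    have ae: "AE x in lebesgue. repr F x = h x"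
      unfolding h_def by (rule fourier_L2_inversion[OF G(1) L1(1)])
    have "square_integrable h"
      using G(1) square_integrable_cong_AE[OF ae borel_measurable_repr meas]
      by (simp add: has_fourier_L2_def)
    then have "h \<in> C0"
      using uniformly_continuous_square_integrable_vanishes[OF uc] uniformly_continuous_imp_continuous[OF uc]
      by (simp add: C0_def)
    moreover have "ae_class h = F"
      using ae_class_eq[OF ae borel_measurable_repr meas] by simp
    ultimately show ?thesis
      using le by blast
  qed
  show ?thesis
    unfolding continuously_embedded_C0_def
  proof (intro conjI ballI exI[of _ K] impI)
    fix F :: "'a ae_fun" assume "F \<in> sobolev_space s"
    from rep[OF this] obtain h where h: "h \<in> C0" "ae_class h = F" "\<And>x. norm (h x) \<le> K * sobolev_norm s F"
      by blast
    show "\<exists>!h. h \<in> C0 \<and> ae_class h = F"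
      using h(1,2) C0_eq_if_ae_class_eq by blast
    fix h' :: "'a \<Rightarrow> complex" assume h': "h' \<in> C0" "ae_class h' = F"
    then have "h' = h"
      using h(1,2) by (intro C0_eq_if_ae_class_eq) simp_all
    then show "sup_norm h' \<le> K * sobolev_norm s F"
      unfolding sup_norm_def using h(3) by (intro cSUP_least) simp_all
  qed
qed

theorem corollary1:
  shows "(\<forall>w :: real ^ 'n \<Rightarrow> real.
            weight w \<and> weakly_subadditive w \<and> square_integrable (\<lambda>x. 1 / w x) \<longrightarrow>
              (\<forall>F\<in>L2w w. \<forall>G\<in>L2w w.
                 AE x in lebesgue. integrable lebesgue (\<lambda>y. repr F (x - y) * repr G y)) \<and>
              banach_algebra_on scale_ae (L2w w) (L2w_norm w) convolution)
       \<and> (\<forall>s\<ge>0.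
            square_integrable (\<lambda>y :: real ^ 'n. 1 / sobolev_weight s y) \<longrightarrow>
              continuously_embedded_C0
                (sobolev_space s :: (real ^ 'n) ae_fun set) (sobolev_norm s))"
proof (rule conjI; intro allI impI)
  fix w :: "real ^ 'n \<Rightarrow> real"
  assume "weight w \<and> weakly_subadditive w \<and> square_integrable (\<lambda>x. 1 / w x)"
  then have w: "weight w" "weakly_subadditive w" and inv: "square_integrable (\<lambda>x. 1 / w x)"
    by simp_all
  have pos: "w x > 0" for x
    using w(1) by (simp add: weight_def)
  have int: "integrable lebesgue (repr F)" if "F \<in> L2w w" for F
    using weighted_square_integrable_imp_integrable(1)[OF pos inv borel_measurable_repr L2wD[OF that]] .
  have "\<forall>F\<in>L2w w. \<forall>G\<in>L2w w.
      AE x in lebesgue. integrable lebesgue (\<lambda>y. repr F (x - y) * repr G y)"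
    by (intro ballI AE_integrable_convolution int)
  then show "(\<forall>F\<in>L2w w. \<forall>G\<in>L2w w.
      AE x in lebesgue. integrable lebesgue (\<lambda>y. repr F (x - y) * repr G y)) \<and>
      banach_algebra_on scale_ae (L2w w) (L2w_norm w) convolution"
    using L2w_banach_algebra[OF w inv] by blast
next
  fix s :: real
  assume "square_integrable (\<lambda>y :: real ^ 'n. 1 / sobolev_weight s y)"
  then show "continuously_embedded_C0 (sobolev_space s :: (real ^ 'n) ae_fun set) (sobolev_norm s)"
    by (rule sobolev_embedding)
qed

end
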